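(* For integers $i,j\ge 0$ let $\psi_s(i,j)$ denote the number of bipartite graphs on a fixed set of $i$ labeled "bottom" vertices and a fixed set of $j$ labeled "top" vertices (edges only between bottom and top) having no isolated vertices; equivalently $\psi_s(i,j)=\sum_{a=0}^{i}\sum_{b=0}^{j}(-1)^{i-a+j-b}\binom{i}{a}\binom{j}{b}2^{ab}$. (1) Let $r\ge 1$ be an integer. Let $V_r=\begin{bmatrix}\sqrt{x^1/1!} & \sqrt{x^2/2!} & \cdots & \sqrt{x^r/r!}\end{bmatrix}^T$ be an $r\times 1$ matrix, let $D_r$ be the $r\times r$ diagonal matrix whose diagonal entries are those of $V_r$, and let $A_r$ be the $r\times r$ matrix with $(i,j)$-entry $\psi_s(i,j)$ for $1\le i,j\le r$. Then the exponential generating function of $p_{n,r,k}$, the number of graded posets on the vertex set $[n]$ of height $k$ with at most $r$ vertices on each rank, is \[P_{r,k}(x)=\sum_n p_{n,r,k}\frac{x^n}{n!}=V_r^T(D_rA_rD_r)^{k-1}V_r,\] and the exponential generating function of $p_{n,r}$, the number of graded posets on $[n]$ with at most $r$ vertices on each rank, is \[P_r(x)=\sum_n p_{n,r}\frac{x^n}{n!}=V_r^T(I_r-D_rA_rD_r)^{-1}V_r.\] (2) Let $V=\begin{bmatrix}\sqrt{x^1/1!} & \sqrt{x^2/2!} & \cdots\end{bmatrix}^T$ be the infinite column vector that is the limit of the $V_r$, and let $D$ and $A$ be the infinite matrices that are the limits of $D_r$ and $A_r$ (entries regarded as formal power series). Then the exponential generating function for the number of graded posets on $n$ vertices is \[P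(x)=V^T(I-DAD)^{-1}V.\]
   Context: All posets are finite. An element $x$ covers $y$ if $y<x$ and there is no $z$ with $y<z<x$. A poset is (strongly) graded if all its maximal chains have the same number of elements; then every element has a rank, with all minimal elements of rank $0$, all maximal elements of rank $M$, and covering increasing rank by exactly $1$. The height of such a poset is $M+1$, the number of ranks. The size of a poset is its number of elements; labeled posets of size $n$ are posets on the vertex set $[n]=\{1,\dots,n\}$, and the exponential generating function of a sequence $e_n$ is $\sum_n e_n x^n/n!$. *)

theory Defs
  imports
    "HOL-Computational_Algebra.Formal_Power_Series"
    "Jordan_Normal_Form.Matrix"
begin

text \<open>A poset is a reflexive order relation: \<open>(x, y) \<in> R\<close> means \<open>x \<le> y\<close>. For such an \<open>R\<close> on \<open>A\<close>,
  the members of \<^term>\<open>Chains R\<close> are exactly the chains contained in \<open>A\<close>.\<close>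

definition maximal_chains :: "('a \<times> 'a) set \<Rightarrow> 'a set set" where
  "maximal_chains R = {C \<in> Chains R. \<forall>C' \<in> Chains R. C \<subseteq> C' \<longrightarrow> C' = C}"

definition covers :: "('a \<times> 'a) set \<Rightarrow> 'a \<Rightarrow> 'a \<Rightarrow> bool" where
  "covers R x y \<longleftrightarrow> (y, x) \<in> R \<and> y \<noteq> x \<and>
     \<not> (\<exists>z. (y, z) \<in> R \<and> y \<noteq> z \<and> (z, x) \<in> R \<and> z \<noteq> x)"

definition minimal_elt :: "'a set \<Rightarrow> ('a \<times> 'a) set \<Rightarrow> 'a \<Rightarrow> bool" where
  "minimal_elt A R x \<longleftrightarrow> x \<in> A \<and> (\<forall>y. (y, x) \<in> R \<longrightarrow> y = x)"

definition maximal_elt :: "'a set \<Rightarrow> ('a \<times> 'a) set \<Rightarrow> 'a \<Rightarrow> bool" where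
  "maximal_elt A R x \<longleftrightarrow> x \<in> A \<and> (\<forall>y. (x, y) \<in> R \<longrightarrow> y = x)"

text \<open>The empty poset is not counted: it has no top rank \<open>M\<close>, and the matrix formulas below have
  constant term \<open>0\<close>.\<close>

definition graded_poset :: "'a set \<Rightarrow> ('a \<times> 'a) set \<Rightarrow> bool" where
  "graded_poset A R \<longleftrightarrow> finite A \<and> A \<noteq> {} \<and> partial_order_on A R \<and>
     (\<forall>C \<in> maximal_chains R. \<forall>C' \<in> maximal_chains R. card C = card C')"

definition rank_function :: "'a set \<Rightarrow> ('a \<times> 'a) set \<Rightarrow> ('a \<Rightarrow> nat) \<Rightarrow> nat \<Rightarrow> bool" where
  "rank_function A R \<rho> M \<longleftrightarrow>
     (\<forall>x. minimal_elt A R x \<longrightarrow> \<rho> x = 0) \<and>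
     (\<forall>x. maximal_elt A R x \<longrightarrow> \<rho> x = M) \<and>
     (\<forall>x y. covers R x y \<longrightarrow> \<rho> x = Suc (\<rho> y))"

text \<open>On a graded poset a rank function exists, and \<open>M\<close> and the values of \<open>\<rho>\<close> on \<open>A\<close> are uniquely
  determined, so the existential quantifiers below make no choice.\<close>

definition has_height :: "'a set \<Rightarrow> ('a \<times> 'a) set \<Rightarrow> nat \<Rightarrow> bool" where
  "has_height A R k \<longleftrightarrow> (\<exists>\<rho> M. rank_function A R \<rho> M \<and> k = M + 1)"

definition ranks_at_most :: "'a set \<Rightarrow> ('a \<times> 'a) set \<Rightarrow> nat \<Rightarrow> bool" where
  "ranks_at_most A R r \<longleftrightarrow>
     (\<exists>\<rho> M. rank_function A R \<rho> M \<and> (\<forall>m. card {x \<in> A. \<rho> x = m} \<le> r))"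

definition num_graded_rk :: "nat \<Rightarrow> nat \<Rightarrow> nat \<Rightarrow> nat" where
  "num_graded_rk n r k =
     card {R. graded_poset {1..n} R \<and> has_height {1..n} R k \<and> ranks_at_most {1..n} R r}"

definition num_graded_r :: "nat \<Rightarrow> nat \<Rightarrow> nat" where
  "num_graded_r n r = card {R. graded_poset {1..n} R \<and> ranks_at_most {1..n} R r}"

definition num_graded :: "nat \<Rightarrow> nat" where
  "num_graded n = card {R. graded_poset {1..n} R}"

text \<open>A bipartite graph is its set of edges (bottom vertex, top vertex).\<close>

definition psi_s :: "nat \<Rightarrow> nat \<Rightarrow> nat" where
  "psi_s i j = card {E. E \<subseteq> {1..i} \<times> {1..j} \<and>
     (\<forall>a \<in> {1..i}. \<exists>b. (a, b) \<in> E) \<and> (\<forall>b \<in> {1..j}. \<exists>a. (a, b) \<in> E)}"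

definition egf :: "(nat \<Rightarrow> nat) \<Rightarrow> real fps" where
  "egf e = Abs_fps (\<lambda>n. of_nat (e n) / fact n)"

text \<open>All matrix entries are power series in the square root of \<open>x\<close>, so \<open>x\<close> itself is
  \<open>sqrt_x ^ 2\<close>, and a series \<open>F(x)\<close> becomes \<open>F oo sqrt_x ^ 2\<close>.\<close>

abbreviation sqrt_x :: "real fps" where
  "sqrt_x \<equiv> fps_X"

definition sqrt_entry :: "nat \<Rightarrow> real fps" where
  "sqrt_entry i = fps_const (1 / sqrt (fact i)) * sqrt_x ^ i"

lemma sqrt_entry_square: "(sqrt_entry i)\<^sup>2 = fps_const (1 / fact i) * (sqrt_x ^ 2) ^ i"
proof -
  have "(fps_const (1 / sqrt (fact i)))\<^sup>2 = (fps_const (1 / fact i) :: real fps)"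
    by (simp add: fps_const_power power_divide)
  then show ?thesis
    by (simp add: sqrt_entry_def power_mult_distrib power_mult [symmetric] mult.commute)
qed

text \<open>Indices of matrices start at \<open>0\<close>, hence the shifts by \<open>Suc\<close>.\<close>

definition V_mat :: "nat \<Rightarrow> real fps mat" where
  "V_mat r = mat r 1 (\<lambda>(i, _). sqrt_entry (Suc i))"

definition D_mat :: "nat \<Rightarrow> real fps mat" where
  "D_mat r = mat r r (\<lambda>(i, j). if i = j then V_mat r $$ (i, 0) else 0)"

definition A_mat :: "nat \<Rightarrow> real fps mat" where
  "A_mat r = mat r r (\<lambda>(i, j). of_nat (psi_s (Suc i) (Suc j)))"

text \<open>The inverse, for invertible \<open>M\<close>.\<close>

definition mat_inv :: "'a :: semiring_1 mat \<Rightarrow> 'a mat" where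
  "mat_inv M = (THE B. inverts_mat M B \<and> inverts_mat B M)"

text \<open>Infinite matrices are functions of row and column index; column vectors have column index
  type \<^typ>\<open>unit\<close>. Infinite sums are taken in the metric topology of formal power series.\<close>

definition imat_mult ::
  "('i \<Rightarrow> nat \<Rightarrow> real fps) \<Rightarrow> (nat \<Rightarrow> 'j \<Rightarrow> real fps) \<Rightarrow> 'i \<Rightarrow> 'j \<Rightarrow> real fps" (infixl "**\<^sub>\<infinity>" 70)
  where "A **\<^sub>\<infinity> B = (\<lambda>i j. \<Sum>k. A i k * B k j)"

definition imat_mult_defined ::
  "('i \<Rightarrow> nat \<Rightarrow> real fps) \<Rightarrow> (nat \<Rightarrow> 'j \<Rightarrow> real fps) \<Rightarrow> bool"
  where "imat_mult_defined A B \<longleftrightarrow> (\<forall>i j. summable (\<lambda>k. A i k * B k j))"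

definition imat_transpose :: "('i \<Rightarrow> 'j \<Rightarrow> real fps) \<Rightarrow> 'j \<Rightarrow> 'i \<Rightarrow> real fps" where
  "imat_transpose A = (\<lambda>i j. A j i)"

definition imat_one :: "nat \<Rightarrow> nat \<Rightarrow> real fps" where
  "imat_one = (\<lambda>i j. if i = j then 1 else 0)"

definition imat_minus ::
  "('i \<Rightarrow> 'j \<Rightarrow> real fps) \<Rightarrow> ('i \<Rightarrow> 'j \<Rightarrow> real fps) \<Rightarrow> 'i \<Rightarrow> 'j \<Rightarrow> real fps" where
  "imat_minus A B = (\<lambda>i j. A i j - B i j)"

definition imat_inverts :: "(nat \<Rightarrow> nat \<Rightarrow> real fps) \<Rightarrow> (nat \<Rightarrow> nat \<Rightarrow> real fps) \<Rightarrow> bool" where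
  "imat_inverts M B \<longleftrightarrow> imat_mult_defined M B \<and> imat_mult_defined B M \<and>
     M **\<^sub>\<infinity> B = imat_one \<and> B **\<^sub>\<infinity> M = imat_one"

text \<open>Only meaningful when the inverse is unique, which can fail for infinite matrices.\<close>

definition imat_inv :: "(nat \<Rightarrow> nat \<Rightarrow> real fps) \<Rightarrow> nat \<Rightarrow> nat \<Rightarrow> real fps" where
  "imat_inv M = (THE B. imat_inverts M B)"

definition V_inf :: "nat \<Rightarrow> unit \<Rightarrow> real fps" where
  "V_inf = (\<lambda>i _. sqrt_entry (Suc i))"

definition D_inf :: "nat \<Rightarrow> nat \<Rightarrow> real fps" where
  "D_inf = (\<lambda>i j. if i = j then V_inf i () else 0)"

definition A_inf :: "nat \<Rightarrow> nat \<Rightarrow> real fps" where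
  "A_inf = (\<lambda>i j. of_nat (psi_s (Suc i) (Suc j)))"

end

theory Submission
  imports
    Defs
    "HOL-Computational_Algebra.Formal_Laurent_Series"
    "Jordan_Normal_Form.Determinant"
begin

text \<open>The order of a graded poset is recovered from its top rank \<open>T\<close>, the order induced on the other
  elements, and the edges between \<open>T\<close> and the rank below; these edges form an arbitrary bipartite
  graph without isolated vertices. Counting by the size of the top rank therefore turns adding one
  rank into one multiplication by \<open>DAD\<close>. Summed over all heights, the row vector \<open>y\<close> of these
  generating functions satisfies \<open>y = V\<^sup>T + y (DAD)\<close>, so \<open>y = V\<^sup>T (I - DAD)\<^bsup>-1\<^esup>\<close>. The infinite system
  is handled by contraction: entry \<open>(i, j)\<close> of \<open>DAD\<close> is divisible by a power of \<open>sqrt_x\<close> that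
  grows with \<open>i + j\<close>.\<close>

section \<open>Rank functions of finite posets\<close>

text \<open>Gradedness is defined by the sizes of maximal chains, which are awkward to follow when
  elements are removed. It is therefore traded for the existence of a rank function, which simply
  restricts to the lower ranks. Peeling at the top works because those ranks form a down-set on
  which the order is unchanged, while all relations into the top rank follow from its edges by
  transitivity. One set \<open>S\<close> of admissible rank sizes serves both the bounded posets
  (\<open>{..r}\<close>) and all posets (\<open>UNIV\<close>). A rank with \<open>t\<close> elements
  contributes x^t/t!. The square roots split this factor evenly between its two neighbours in the
  matrix product, which is why \<open>total_row\<close> carries one root less than
  \<open>total_egf\<close>. In the infinite system products need not associate, inverses need not be
  unique, and the identity matrix has no decaying entries. Every rearrangement of sums thus rests on
  one condition, that term \<open>k\<close> be divisible by \<open>fps_X ^ k\<close>, and the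
  Neumann series is taken without its identity term.\<close>

locale finite_poset =
  fixes A :: "'a set" and R :: "('a \<times> 'a) set"
  assumes finite_carrier: "finite A" and order: "partial_order_on A R"
begin

lemma refl_le: "x \<in> A \<Longrightarrow> (x, x) \<in> R"
  and trans_le: "(x, y) \<in> R \<Longrightarrow> (y, z) \<in> R \<Longrightarrow> (x, z) \<in> R"
  and antisym_le: "(x, y) \<in> R \<Longrightarrow> (y, x) \<in> R \<Longrightarrow> x = y"
  and le_carrier: "(x, y) \<in> R \<Longrightarrow> x \<in> A" "(x, y) \<in> R \<Longrightarrow> y \<in> A"
  using partial_order_onD[OF order] by (auto simp: refl_on_def dest: transD antisymD)

lemma order_subset: "R \<subseteq> A \<times> A"
  by (rule partial_order_onD(4)[OF order])

lemma finite_order: "finite R"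
  using finite_carrier partial_order_onD(4)[OF order] finite_subset by blast

lemma converse: "finite_poset A (R\<inverse>)"
  using finite_carrier order by unfold_locales auto

lemma wf_less: "wf (R - Id)"
  using finite_order order by (rule partial_order_on_well_order_on)

lemma min_in:
  assumes "x \<in> Q"
  obtains z where "z \<in> Q" "\<And>y. y \<in> Q \<Longrightarrow> (y, z) \<in> R \<Longrightarrow> y = z"
  using wfE_min[OF wf_less assms] by (metis Diff_iff pair_in_Id_conv)

lemma max_in:
  assumes "x \<in> Q"
  obtains z where "z \<in> Q" "\<And>y. y \<in> Q \<Longrightarrow> (z, y) \<in> R \<Longrightarrow> y = z"
  using finite_poset.min_in[OF converse assms] by (metis converse_iff)

lemma coversD: "covers R y x \<Longrightarrow> (x, y) \<in> R" "covers R y x \<Longrightarrow> x \<noteq> y"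
  "covers R y x \<Longrightarrow> (x, z) \<in> R \<Longrightarrow> (z, y) \<in> R \<Longrightarrow> z = x \<or> z = y"
  by (auto simp: covers_def)

text \<open>A maximal element of the half-open interval from \<open>x\<close> (included) to
  \<open>y\<close> (excluded) is covered by \<open>y\<close>.\<close>

lemma lower_cover_above:
  assumes "(x, y) \<in> R" "x \<noteq> y"
  obtains z where "covers R y z" "(x, z) \<in> R"
proof -
  have "x \<in> {z. (x, z) \<in> R \<and> (z, y) \<in> R \<and> z \<noteq> y}"
    using assms refl_le le_carrier by auto
  then obtain z where z: "(x, z) \<in> R" "(z, y) \<in> R" "z \<noteq> y"
    and max: "\<And>w. (x, w) \<in> R \<Longrightarrow> (w, y) \<in> R \<Longrightarrow> w \<noteq> y \<Longrightarrow> (z, w) \<in> R \<Longrightarrow> w = z"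
    by (rule max_in) blast
  have "covers R y z"
    using z max trans_le unfolding covers_def by metis
  with z show thesis using that by blast
qed

lemma upper_cover_below:
  assumes "(x, y) \<in> R" "x \<noteq> y"
  obtains z where "covers R z x" "(z, y) \<in> R"
proof -
  have "covers (R\<inverse>) x z \<longleftrightarrow> covers R z x" for z
    by (auto simp: covers_def)
  with finite_poset.lower_cover_above[OF converse, of y x] assms that show thesis by auto
qed

lemma maximal_above:
  assumes "x \<in> A"
  obtains y where "maximal_elt A R y" "(x, y) \<in> R"
proof -
  have "x \<in> {y. (x, y) \<in> R}" using assms refl_le by auto
  then obtain y where "(x, y) \<in> R" "\<And>z. (x, z) \<in> R \<Longrightarrow> (y, z) \<in> R \<Longrightarrow> z = y"
    by (rule max_in) blast
  then show thesis using that trans_le le_carrier unfolding maximal_elt_def by metis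
qed

lemma minimal_below:
  assumes "x \<in> A"
  obtains y where "minimal_elt A R y" "(y, x) \<in> R"
proof -
  have "maximal_elt A (R\<inverse>) y \<longleftrightarrow> minimal_elt A R y" for y
    by (auto simp: maximal_elt_def minimal_elt_def)
  with finite_poset.maximal_above[OF converse assms] that show thesis by auto
qed

lemma restrict:
  assumes "B \<subseteq> A"
  shows "finite_poset B (R \<inter> B \<times> B)"
proof
  show "finite B" using assms finite_carrier finite_subset by blast
  have "trans (R \<inter> B \<times> B)" using trans_le unfolding trans_def by blast
  moreover have "antisym (R \<inter> B \<times> B)" using antisym_le unfolding antisym_def by blast
  ultimately show "partial_order_on B (R \<inter> B \<times> B)"
    using assms refl_le by (auto simp: partial_order_on_def preorder_on_def refl_on_def)
qed

end

lemma graded_poset_iff_maximal_chains: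
  "graded_poset A R \<longleftrightarrow> finite_poset A R \<and> A \<noteq> {} \<and>
    (\<forall>C \<in> maximal_chains R. \<forall>C' \<in> maximal_chains R. card C = card C')"
  unfolding graded_poset_def finite_poset_def by blast

locale ranked_poset = finite_poset +
  fixes \<rho> :: "'a \<Rightarrow> nat" and M :: nat
  assumes rank: "rank_function A R \<rho> M"
begin

lemma rank_minimal: "minimal_elt A R x \<Longrightarrow> \<rho> x = 0"
  and rank_maximal: "maximal_elt A R x \<Longrightarrow> \<rho> x = M"
  and rank_covers: "covers R y x \<Longrightarrow> \<rho> y = Suc (\<rho> x)"
  using rank by (auto simp: rank_function_def)

text \<open>Induction on \<open>y\<close>: if \<open>x\<close> is strictly below \<open>y\<close>,
  some lower cover of \<open>y\<close> is still above \<open>x\<close>, and passing from it to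
  \<open>y\<close> adds 1 to the rank.\<close>

lemma rank_mono: "(x, y) \<in> R \<Longrightarrow> \<rho> x \<le> \<rho> y"
proof (induction y rule: wf_induct_rule[OF wf_less])
  case (1 y)
  show ?case
  proof (cases "x = y")
    case False
    then obtain z where z: "covers R y z" "(x, z) \<in> R" using 1 lower_cover_above by metis
    have "\<rho> x \<le> \<rho> z" using 1 z coversD[OF z(1)] by auto
    then show ?thesis using rank_covers[OF z(1)] by simp
  qed simp
qed

lemma rank_strict_mono: "(x, y) \<in> R \<Longrightarrow> x \<noteq> y \<Longrightarrow> \<rho> x < \<rho> y"
  by (metis lower_cover_above rank_mono rank_covers less_Suc_eq_le)

lemma rank_le: "x \<in> A \<Longrightarrow> \<rho> x \<le> M"
  by (metis maximal_above rank_maximal rank_mono)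

lemma rank_eq_top_iff: "x \<in> A \<Longrightarrow> \<rho> x = M \<longleftrightarrow> maximal_elt A R x"
  by (metis rank_maximal maximal_above rank_strict_mono less_irrefl)

text \<open>The values propagate upwards: they are fixed on minimal elements, and every other
  element covers some element.\<close>

lemma rank_unique:
  assumes "rank_function A R \<rho>' M'" "x \<in> A"
  shows "\<rho>' x = \<rho> x"
proof -
  interpret r': ranked_poset A R \<rho>' M' using assms(1) by unfold_locales
  show ?thesis using assms(2)
  proof (induction x rule: wf_induct_rule[OF wf_less])
    case (1 x)
    show ?case
    proof (cases "minimal_elt A R x")
      case True
      then show ?thesis using rank_minimal r'.rank_minimal by simp
    next
      case False
      then obtain y where y: "(y, x) \<in> R" "y \<noteq> x"
        using 1(2) by (auto simp: minimal_elt_def)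
      then obtain z where z: "covers R x z" by (metis lower_cover_above)
      then show ?thesis
        using 1(1)[of z] coversD(1,2)[OF z] le_carrier rank_covers r'.rank_covers by auto
    qed
  qed
qed

text \<open>Both values are compared at a maximal element; over the empty poset every
  \<open>M\<close> would qualify.\<close>

lemma top_unique:
  assumes "rank_function A R \<rho>' M'" "A \<noteq> {}"
  shows "M' = M"
proof -
  interpret r': ranked_poset A R \<rho>' M' using assms(1) by unfold_locales
  obtain x where "maximal_elt A R x" using assms(2) maximal_above by blast
  then show ?thesis
    using rank_unique[OF assms(1), of x] rank_maximal r'.rank_maximal
    by (auto simp: maximal_elt_def)
qed

text \<open>A maximal chain starts at a minimal element, cannot stop before a maximal one, and
  climbs by covers, so it meets every rank.\<close>

lemma rank_image_maximal_chain:
  assumes "A \<noteq> {}" "C \<in> maximal_chains R"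
  shows "\<rho> ` C = {..M}"
proof -
  have comp: "(a, b) \<in> R \<or> (b, a) \<in> R" if "a \<in> C" "b \<in> C" for a b
    using assms(2) that by (auto simp: maximal_chains_def Chains_def)
  \<comment> \<open>The form in which maximality of \<open>C\<close> is used: whatever is comparable
    to all of \<open>C\<close> already belongs to it.\<close>
  have ext: "x \<in> C" if "x \<in> A" "\<And>c. c \<in> C \<Longrightarrow> (x, c) \<in> R \<or> (c, x) \<in> R" for x
  proof -
    have "insert x C \<in> Chains R"
      using comp that refl_le by (auto simp: Chains_def)
    then show ?thesis using assms(2) by (auto simp: maximal_chains_def)
  qed
  have CA: "C \<subseteq> A" using comp le_carrier by blast
  have "C \<noteq> {}" using ext assms(1) by auto
  have "m \<le> M \<Longrightarrow> \<exists>x\<in>C. \<rho> x = m" for m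
  proof (induction m)
    case 0
    obtain x where x: "x \<in> C" "\<And>y. y \<in> C \<Longrightarrow> (y, x) \<in> R \<Longrightarrow> y = x"
      using \<open>C \<noteq> {}\<close> min_in by (metis all_not_in_conv)
    have "minimal_elt A R x"
      unfolding minimal_elt_def
    proof (intro conjI allI impI)
      fix y assume y: "(y, x) \<in> R"
      have "y \<in> C" using y x comp trans_le le_carrier by (intro ext) metis+
      with x y show "y = x" by blast
    qed (use x CA in auto)
    with x rank_minimal show ?case by blast
  next
    case (Suc m)
    then obtain x where x: "x \<in> C" "\<rho> x = m" by auto
    \<comment> \<open>The chain cannot end at \<open>x\<close>: as \<open>\<rho> x < M\<close>, some
      \<open>y\<close> lies above \<open>x\<close>, and it would be above the whole chain.\<close>
    have "\<exists>u\<in>C. (x, u) \<in> R \<and> u \<noteq> x"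
    proof (rule ccontr)
      assume no: "\<not> ?thesis"
      have "\<not> maximal_elt A R x" using x Suc.prems rank_maximal by force
      then obtain y where y: "(x, y) \<in> R" "y \<noteq> x"
        using x CA by (auto simp: maximal_elt_def)
      have "y \<in> C" using no y x comp trans_le le_carrier by (intro ext) metis+
      with no y show False by blast
    qed
    then obtain u where "u \<in> {u \<in> C. (x, u) \<in> R \<and> u \<noteq> x}" by blast
    then obtain z where z: "z \<in> C" "(x, z) \<in> R" "z \<noteq> x"
      and min: "\<And>w. w \<in> C \<Longrightarrow> (x, w) \<in> R \<Longrightarrow> w \<noteq> x \<Longrightarrow> (w, z) \<in> R \<Longrightarrow> w = z"
      by (rule min_in) blast
    \<comment> \<open>The next chain element \<open>z\<close> after \<open>x\<close> covers
      \<open>x\<close>: an intermediate \<open>w\<close> would be comparable to the members up to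
      \<open>x\<close> and to those from \<open>z\<close> on, hence lie in \<open>C\<close> and
      contradict the choice of \<open>z\<close>.\<close>
    have between: False if w: "(x, w) \<in> R" "x \<noteq> w" "(w, z) \<in> R" "w \<noteq> z" for w
    proof -
      have "(w, c) \<in> R \<or> (c, w) \<in> R" if "c \<in> C" for c
      proof (cases "(c, x) \<in> R")
        case False
        then have "(z, c) \<in> R"
          using min[of c] comp[of c x] comp[of c z] that x z refl_le CA by blast
        then show ?thesis using w trans_le by blast
      qed (use w trans_le in blast)
      then have "w \<in> C" using w le_carrier by (intro ext) blast+
      with min w show False by metis
    qed
    with z have "covers R z x" unfolding covers_def by blast
    then show ?case using rank_covers x z by blast
  qed
  then show ?thesis using rank_le CA by (force simp: image_def)
qed

lemma card_maximal_chain: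
  assumes "A \<noteq> {}" "C \<in> maximal_chains R"
  shows "card C = Suc M"
proof -
  have "(a, b) \<in> R \<or> (b, a) \<in> R" if "a \<in> C" "b \<in> C" for a b
    using assms(2) that by (auto simp: maximal_chains_def Chains_def)
  then have "inj_on \<rho> C"
    using rank_strict_mono by (metis inj_onI less_irrefl)
  then have "card (\<rho> ` C) = card C" by (rule card_image)
  then show ?thesis by (simp add: rank_image_maximal_chain[OF assms])
qed

end

section \<open>Existence of a rank function when all maximal chains have the same size\<close>

context finite_poset
begin

definition chains_to :: "'a \<Rightarrow> 'a set set" where
  "chains_to x = {C \<in> Chains R. x \<in> C \<and> (\<forall>c\<in>C. (c, x) \<in> R)}"

text \<open>Maximality is relative to chains with greatest element \<open>x\<close>, so these are
  the saturated chains from a minimal element up to \<open>x\<close>.\<close>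

definition maximal_chains_to :: "'a \<Rightarrow> 'a set set" where
  "maximal_chains_to x = {C \<in> chains_to x. \<forall>C' \<in> chains_to x. C \<subseteq> C' \<longrightarrow> C' = C}"

lemma Chains_carrier: "C \<in> Chains R \<Longrightarrow> C \<subseteq> A"
  using le_carrier by (auto simp: Chains_def)

lemma finite_Chains: "finite (Chains R)"
  using Chains_carrier finite_carrier by (meson Pow_iff finite_Pow_iff finite_subset subsetI)

lemma maximal_chains_to_nonempty:
  assumes "x \<in> A"
  shows "maximal_chains_to x \<noteq> {}"
proof -
  have "finite (chains_to x)"
    using finite_Chains by (simp add: chains_to_def)
  moreover have "{x} \<in> chains_to x"
    using assms refl_le by (auto simp: chains_to_def Chains_def)
  ultimately obtain C where "C \<in> chains_to x" "\<forall>C'\<in>chains_to x. C \<subseteq> C' \<longrightarrow> C = C'"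
    using finite_has_maximal[of "chains_to x"] by auto
  then show ?thesis by (auto simp: maximal_chains_to_def)
qed

text \<open>Completing two chains below \<open>x\<close> by the same chain above \<open>x\<close> compares their sizes.\<close>

lemma card_maximal_chains_to_eq:
  assumes eq: "\<And>C C'. C \<in> maximal_chains R \<Longrightarrow> C' \<in> maximal_chains R \<Longrightarrow> card C = card C'"
    and C: "C \<in> maximal_chains_to x" and D: "D \<in> maximal_chains_to x"
  shows "card C = card D"
proof -
  have x: "x \<in> A" using C Chains_carrier by (auto simp: maximal_chains_to_def chains_to_def)
  interpret dual: finite_poset A "R\<inverse>" by (rule converse)
  obtain U where U: "U \<in> dual.maximal_chains_to x"
    using dual.maximal_chains_to_nonempty[OF x] by blast
  have Udef: "U \<in> Chains R" "x \<in> U" "\<And>u. u \<in> U \<Longrightarrow> (x, u) \<in> R"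
    using U by (auto simp: dual.maximal_chains_to_def dual.chains_to_def Chains_def)
  have key: "E \<union> U \<in> maximal_chains R \<and> E \<inter> U = {x} \<and> finite E" if E: "E \<in> maximal_chains_to x" for E
  proof -
    have Edef: "E \<in> Chains R" "x \<in> E" "\<And>u. u \<in> E \<Longrightarrow> (u, x) \<in> R"
      using E by (auto simp: maximal_chains_to_def chains_to_def)
    have ch: "E \<union> U \<in> Chains R"
      using Edef Udef trans_le unfolding Chains_def by blast
    \<comment> \<open>A larger chain contains \<open>x\<close> and splits there into a lower and an
      upper part; maximality of \<open>E\<close> and of \<open>U\<close> among such parts leaves no
      room.\<close>
    have "C' = E \<union> U" if C': "C' \<in> Chains R" "E \<union> U \<subseteq> C'" for C'
    proof -
      have "{c \<in> C'. (c, x) \<in> R} \<in> chains_to x"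
        using C' Edef refl_le x by (auto simp: chains_to_def Chains_def)
      moreover have "E \<subseteq> {c \<in> C'. (c, x) \<in> R}" using C' Edef by auto
      ultimately have 1: "{c \<in> C'. (c, x) \<in> R} = E"
        using E by (auto simp: maximal_chains_to_def)
      have "{c \<in> C'. (x, c) \<in> R} \<in> dual.chains_to x"
        using C' Edef refl_le x by (auto simp: dual.chains_to_def Chains_def)
      moreover have "U \<subseteq> {c \<in> C'. (x, c) \<in> R}" using C' Udef by auto
      ultimately have 2: "{c \<in> C'. (x, c) \<in> R} = U"
        using U by (auto simp: dual.maximal_chains_to_def)
      have "(c, x) \<in> R \<or> (x, c) \<in> R" if "c \<in> C'" for c
        using that C' Edef by (auto simp: Chains_def)
      with 1 2 show ?thesis by blast
    qed
    with ch have "E \<union> U \<in> maximal_chains R" unfolding maximal_chains_def by blast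
    moreover have "E \<inter> U = {x}" using Edef Udef antisym_le by blast
    moreover have "finite E" using Chains_carrier[OF Edef(1)] finite_carrier finite_subset by blast
    ultimately show ?thesis by blast
  qed
  have "finite U" using Chains_carrier[OF Udef(1)] finite_carrier finite_subset by blast
  then have "card C + card U = card D + card U"
    using key[OF C] key[OF D] eq card_Un_Int[of C U] card_Un_Int[of D U] by metis
  then show ?thesis by simp
qed

text \<open>The rank of \<open>x\<close> is the number of steps in any saturated chain from a
  minimal element up to \<open>x\<close>; equal sizes of maximal chains make this independent of the
  chain.\<close>

lemma rank_function_exists:
  assumes ne: "A \<noteq> {}"
    and eq: "\<And>C C'. C \<in> maximal_chains R \<Longrightarrow> C' \<in> maximal_chains R \<Longrightarrow> card C = card C'"
  obtains \<rho> M where "rank_function A R \<rho> M"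
proof -
  have eq_to: "card C = card D" if "C \<in> maximal_chains_to x" "D \<in> maximal_chains_to x" for C D x
    using card_maximal_chains_to_eq[of C x D] eq that by blast
  define \<rho> where "\<rho> x = card (SOME C. C \<in> maximal_chains_to x) - 1" for x
  have \<rho>: "\<rho> x = card C - 1" if "C \<in> maximal_chains_to x" for x C
    using eq_to[OF someI[of "\<lambda>C. C \<in> maximal_chains_to x", OF that] that] by (simp add: \<rho>_def)
  have min: "\<rho> x = 0" if x: "minimal_elt A R x" for x
  proof -
    have "{x} \<in> maximal_chains_to x"
      using x refl_le
      by (auto simp: minimal_elt_def maximal_chains_to_def chains_to_def Chains_def)
    from \<rho>[OF this] show ?thesis by simp
  qed
  have cov: "\<rho> y = Suc (\<rho> x)" if c: "covers R y x" for x y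
  proof -
    have xy: "(x, y) \<in> R" "x \<noteq> y" using coversD c by blast+
    then obtain C where C: "C \<in> maximal_chains_to x"
      using maximal_chains_to_nonempty le_carrier by blast
    have Cdef: "C \<in> Chains R" "x \<in> C" "\<And>u. u \<in> C \<Longrightarrow> (u, x) \<in> R"
      using C by (auto simp: maximal_chains_to_def chains_to_def)
    have yC: "y \<notin> C" using Cdef xy antisym_le by blast
    have finC: "finite C" using Chains_carrier[OF Cdef(1)] finite_carrier finite_subset by blast
    have ins: "insert y C \<in> chains_to y"
    proof -
      have "(c, y) \<in> R" if "c \<in> C" for c using Cdef that xy trans_le by blast
      moreover have "(y, y) \<in> R" using refl_le le_carrier xy by blast
      ultimately show ?thesis using Cdef(1) unfolding chains_to_def Chains_def by simp
    qed
    \<comment> \<open>A saturated chain to \<open>x\<close> extended by a cover \<open>y\<close>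
      stays saturated: in a chain ending at \<open>y\<close> that contains \<open>x\<close>, all
      members except \<open>y\<close> are below \<open>x\<close>, since nothing lies strictly
      between.\<close>
    have "C' = insert y C" if C': "C' \<in> chains_to y" "insert y C \<subseteq> C'" for C'
    proof -
      have C'': "C' \<in> Chains R" "\<And>u. u \<in> C' \<Longrightarrow> (u, y) \<in> R"
        using C' by (auto simp: chains_to_def)
      have "{u \<in> C'. (u, x) \<in> R} \<in> chains_to x"
        using C'' C' Cdef refl_le by (auto simp: chains_to_def Chains_def)
      then have "{u \<in> C'. (u, x) \<in> R} = C"
        using C C' Cdef by (auto simp: maximal_chains_to_def)
      moreover have "(u, x) \<in> R \<or> u = y" if "u \<in> C'" for u
      proof -
        have "(u, x) \<in> R \<or> (x, u) \<in> R" using that C'' C' Cdef by (auto simp: Chains_def)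
        then show ?thesis using coversD(3)[OF c] C''(2)[OF that] Cdef by blast
      qed
      ultimately show ?thesis using C' by blast
    qed
    with ins have "insert y C \<in> maximal_chains_to y" unfolding maximal_chains_to_def by blast
    moreover have "card C > 0" using finC Cdef(2) by (auto simp: card_gt_0_iff)
    ultimately show ?thesis using \<rho>[OF C] \<rho>[of "insert y C" y] yC finC by simp
  qed
  obtain m where m: "maximal_elt A R m" using ne maximal_above by blast
  \<comment> \<open>Above a maximal \<open>x\<close> nothing can be added, so relative and absolute
    maximality agree. This gives all maximal elements the same rank, the value of
    \<open>M\<close>.\<close>
  have toC: "C \<in> maximal_chains R" if x: "maximal_elt A R x" "C \<in> maximal_chains_to x" for x C
  proof -
    have Cdef: "C \<in> Chains R" "x \<in> C" "\<And>u. u \<in> C \<Longrightarrow> (u, x) \<in> R"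
      using x by (auto simp: maximal_chains_to_def chains_to_def)
    have "C' = C" if C': "C' \<in> Chains R" "C \<subseteq> C'" for C'
    proof -
      have "(c, x) \<in> R" if "c \<in> C'" for c
      proof -
        have "(c, x) \<in> R \<or> (x, c) \<in> R" using C' Cdef(2) that unfolding Chains_def by blast
        then show ?thesis using x(1) refl_le unfolding maximal_elt_def by metis
      qed
      then have "C' \<in> chains_to x" using C' Cdef(2) unfolding chains_to_def by blast
      then show ?thesis using C' x(2) unfolding maximal_chains_to_def by blast
    qed
    then show ?thesis using Cdef unfolding maximal_chains_def by blast
  qed
  have "\<rho> x = \<rho> m" if x: "maximal_elt A R x" for x
  proof -
    have "x \<in> A" "m \<in> A" using x m by (auto simp: maximal_elt_def)
    then obtain C D where "C \<in> maximal_chains_to x" "D \<in> maximal_chains_to m"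
      using maximal_chains_to_nonempty by blast
    then show ?thesis using toC x m eq \<rho> by metis
  qed
  with min cov have "rank_function A R \<rho> (\<rho> m)" unfolding rank_function_def by blast
  then show thesis by (rule that)
qed

end

text \<open>The passage from chains to rank functions; everything below works with rank functions
  only.\<close>

lemma graded_poset_iff:
  "graded_poset A R \<longleftrightarrow> finite_poset A R \<and> A \<noteq> {} \<and> (\<exists>\<rho> M. rank_function A R \<rho> M)"
proof -
  have "card C = card C'"
    if "finite_poset A R" "A \<noteq> {}" "rank_function A R \<rho> M"
      "C \<in> maximal_chains R" "C' \<in> maximal_chains R" for \<rho> M C C'
  proof -
    interpret ranked_poset A R \<rho> M
      using that by (simp add: ranked_poset.intro ranked_poset_axioms.intro)
    show ?thesis using card_maximal_chain that by simp
  qed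
  then show ?thesis
    unfolding graded_poset_iff_maximal_chains
    using finite_poset.rank_function_exists[of A R] by metis
qed

section \<open>Adding and removing a top rank\<close>

text \<open>\<open>k\<close> is the index of the top rank, so the height is \<open>k + 1\<close>.
  The order determines \<open>T\<close>, which is nevertheless a parameter so that orders with a
  prescribed top rank can be counted. As \<open>m\<close> runs over all naturals, the empty classes
  above rank \<open>k\<close> force \<open>0 \<in> S\<close>.\<close>

definition layered :: "nat set \<Rightarrow> nat \<Rightarrow> 'a set \<Rightarrow> 'a set \<Rightarrow> ('a \<times> 'a) set \<Rightarrow> bool" where
  "layered S k A T R \<longleftrightarrow> finite_poset A R \<and> A \<noteq> {} \<and> T = {x. maximal_elt A R x} \<and>
     (\<exists>\<rho>. rank_function A R \<rho> k \<and> (\<forall>m. card {x \<in> A. \<rho> x = m} \<in> S))"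

definition spanning :: "'a set \<Rightarrow> 'b set \<Rightarrow> ('a \<times> 'b) set \<Rightarrow> bool" where
  "spanning X Y E \<longleftrightarrow> E \<subseteq> X \<times> Y \<and> (\<forall>a\<in>X. \<exists>b. (a, b) \<in> E) \<and> (\<forall>b\<in>Y. \<exists>a. (a, b) \<in> E)"

text \<open>For \<open>E\<close> going from maximal elements of \<open>R\<close> to
  \<open>T\<close>, this is the order generated by \<open>R\<close>, \<open>E\<close> and
  reflexivity on \<open>T\<close>; reflexivity of \<open>R\<close> puts \<open>E\<close> itself into
  \<open>R O E\<close>.\<close>

definition add_top :: "('a \<times> 'a) set \<Rightarrow> ('a \<times> 'a) set \<Rightarrow> 'a set \<Rightarrow> ('a \<times> 'a) set" where
  "add_top R E T = R \<union> R O E \<union> Id_on T"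

lemma layeredE:
  assumes "layered S k A T R"
  obtains \<rho> where "ranked_poset A R \<rho> k" "A \<noteq> {}" "\<forall>m. card {x \<in> A. \<rho> x = m} \<in> S"
    "T = {x. maximal_elt A R x}" "T = {x \<in> A. \<rho> x = k}"
proof -
  obtain \<rho> where \<rho>: "finite_poset A R" "rank_function A R \<rho> k" "A \<noteq> {}"
    "\<And>m. card {x \<in> A. \<rho> x = m} \<in> S" "T = {x. maximal_elt A R x}"
    using assms unfolding layered_def by blast
  interpret ranked_poset A R \<rho> k
    using \<rho> by (simp add: ranked_poset.intro ranked_poset_axioms.intro)
  have "maximal_elt A R x \<longleftrightarrow> x \<in> A \<and> \<rho> x = k" for x
    using rank_eq_top_iff[of x] unfolding maximal_elt_def by blast
  then have "T = {x \<in> A. \<rho> x = k}" unfolding \<rho>(5) by blast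
  with \<rho> that ranked_poset_axioms show thesis by blast
qed

lemma layered_card_top: "layered S k A T R \<Longrightarrow> card T \<in> S"
  by (elim layeredE) metis

lemma layered_0_iff:
  assumes "0 \<in> S"
  shows "layered S 0 A T R \<longleftrightarrow> finite A \<and> A \<noteq> {} \<and> T = A \<and> card A \<in> S \<and> R = Id_on A"
proof
  assume "layered S 0 A T R"
  then obtain \<rho> where r: "ranked_poset A R \<rho> 0" "A \<noteq> {}" "\<forall>m. card {x \<in> A. \<rho> x = m} \<in> S"
    "T = {x. maximal_elt A R x}" "T = {x \<in> A. \<rho> x = 0}" by (rule layeredE)
  interpret ranked_poset A R \<rho> 0 by fact
  have T: "T = A" using r(5) rank_le by auto
  have "R = Id_on A"
  proof (intro equalityI subrelI)
    fix x y assume xy: "(x, y) \<in> R"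
    then have "x \<in> T" using T le_carrier by simp
    then have "y = x" using r(4) xy by (simp add: maximal_elt_def)
    then show "(x, y) \<in> Id_on A" using xy le_carrier by auto
  qed (use refl_le in auto)
  moreover have "card A \<in> S" using r(3)[rule_format, of 0] r(5) T by simp
  ultimately show "finite A \<and> A \<noteq> {} \<and> T = A \<and> card A \<in> S \<and> R = Id_on A"
    using T r(2) finite_carrier by blast
next
  assume a: "finite A \<and> A \<noteq> {} \<and> T = A \<and> card A \<in> S \<and> R = Id_on A"
  have "partial_order_on A (Id_on A)"
    by (auto simp: partial_order_on_def preorder_on_def refl_on_def trans_def antisym_def)
  moreover have "rank_function A (Id_on A) (\<lambda>_. 0) 0"
    by (auto simp: rank_function_def covers_def)
  moreover have "card {x \<in> A. 0 = (m::nat)} \<in> S" for m using a assms by (cases m) auto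
  ultimately show "layered S 0 A T R"
    using a by (auto simp: layered_def finite_poset_def maximal_elt_def)
qed

text \<open>The two halves of \<open>spanning\<close> do different work: an edge out of every old
  top element stops it from staying maximal at rank \<open>k\<close>, and an edge into every new
  element stops it from being minimal at rank \<open>Suc k\<close>.\<close>

lemma layered_add_top:
  assumes L: "layered S k B T' R" and E: "spanning T' T E" and T: "finite T" "T \<noteq> {}" "card T \<in> S"
    and disj: "B \<inter> T = {}" and "0 \<in> S"
  shows "layered S (Suc k) (B \<union> T) T (add_top R E T)"
proof -
  obtain \<rho> where r: "ranked_poset B R \<rho> k" "B \<noteq> {}" "\<forall>m. card {x \<in> B. \<rho> x = m} \<in> S"
    "T' = {x. maximal_elt B R x}" "T' = {x \<in> B. \<rho> x = k}" using L by (rule layeredE)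
  interpret ranked_poset B R \<rho> k by fact
  let ?R = "add_top R E T"
  have ET: "(x, y) \<in> E \<Longrightarrow> x \<in> T' \<and> y \<in> T" for x y using E by (auto simp: spanning_def)
  have T'B: "T' \<subseteq> B" using r(5) by auto
  have max: "x \<in> T' \<Longrightarrow> (x, y) \<in> R \<Longrightarrow> y = x" for x y
    using r(4) by (auto simp: maximal_elt_def)
  have le: "(x, y) \<in> ?R \<longleftrightarrow> (x, y) \<in> R \<or> (\<exists>e. (x, e) \<in> R \<and> (e, y) \<in> E) \<or> x = y \<and> x \<in> T" for x y
    by (auto simp: add_top_def)
  have le_B: "(x, y) \<in> ?R \<longleftrightarrow> (x, y) \<in> R" if "y \<in> B" for x y
    using that disj ET unfolding le by blast
  have le_T: "(x, y) \<in> ?R \<longleftrightarrow> y = x" if "x \<in> T" for x y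
    using that disj le_carrier unfolding le by blast
  have "finite_poset (B \<union> T) ?R"
  proof
    show "finite (B \<union> T)" using finite_carrier T by simp
    have "?R \<subseteq> (B \<union> T) \<times> (B \<union> T)"
      using order_subset ET by (auto simp: add_top_def)
    moreover have "refl_on (B \<union> T) ?R"
      using refl_le by (auto simp: refl_on_def le)
    moreover have "antisym ?R"
      using antisym_le le_carrier ET disj unfolding antisym_def le by blast
    moreover have "trans ?R"
    proof (rule transI)
      fix x y z assume xy: "(x, y) \<in> ?R" and yz: "(y, z) \<in> ?R"
      show "(x, z) \<in> ?R"
      proof (cases "y \<in> T")
        case True
        then show ?thesis using xy yz le_T by simp
      next
        case False
        then have "y \<in> B" using yz le le_carrier by blast
        then have "(x, y) \<in> R" using xy le_B by simp
        then show ?thesis using yz trans_le False unfolding le by blast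
      qed
    qed
    ultimately show "partial_order_on (B \<union> T) ?R"
      by (simp add: partial_order_on_def preorder_on_def)
  qed
  moreover have maxT: "maximal_elt (B \<union> T) ?R x \<longleftrightarrow> x \<in> T" for x
  proof
    assume m: "maximal_elt (B \<union> T) ?R x"
    show "x \<in> T"
    proof (rule ccontr)
      assume "x \<notin> T"
      then have x: "x \<in> B" using m by (auto simp: maximal_elt_def)
      then obtain y where y: "maximal_elt B R y" "(x, y) \<in> R" by (rule maximal_above)
      then obtain t where t: "(y, t) \<in> E" using r(4) E by (auto simp: spanning_def)
      then have "(x, t) \<in> ?R" using y le by blast
      then have "t = x" using m by (auto simp: maximal_elt_def)
      then show False using ET t x disj by blast
    qed
  qed (auto simp: maximal_elt_def le_T)
  moreover
  define \<rho>' where "\<rho>' x = (if x \<in> T then Suc k else \<rho> x)" for x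
  have "rank_function (B \<union> T) ?R \<rho>' (Suc k)"
    unfolding rank_function_def
  proof (intro conjI allI impI)
    fix x assume m: "minimal_elt (B \<union> T) ?R x"
    have "x \<notin> T"
    proof
      assume "x \<in> T"
      then obtain a where a: "(a, x) \<in> E" using E by (auto simp: spanning_def)
      then have "(a, x) \<in> ?R" "a \<in> B" using ET T'B refl_le le by blast+
      then have "a = x" using m by (auto simp: minimal_elt_def)
      then show False using \<open>a \<in> B\<close> \<open>x \<in> T\<close> disj by blast
    qed
    moreover from this have "minimal_elt B R x"
      using m le_B by (auto simp: minimal_elt_def)
    ultimately show "\<rho>' x = 0" using rank_minimal by (simp add: \<rho>'_def)
  next
    fix x assume "maximal_elt (B \<union> T) ?R x"
    then show "\<rho>' x = Suc k" using maxT by (simp add: \<rho>'_def)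
  next
    fix x y assume c: "covers ?R x y"
    then have yx: "(y, x) \<in> ?R" "y \<noteq> x" by (auto simp: covers_def)
    show "\<rho>' x = Suc (\<rho>' y)"
    proof (cases "x \<in> T")
      case True
      \<comment> \<open>Every strict relation into the new rank passes through an edge
        \<open>(e, x)\<close>; since \<open>x\<close> covers \<open>y\<close>, the intermediate
        \<open>e\<close> must be \<open>y\<close>, which therefore has rank
        \<open>k\<close>.\<close>
      then obtain e where e: "(y, e) \<in> R" "(e, x) \<in> E"
        using yx le_carrier disj unfolding le by blast
      have "e = y"
      proof (rule ccontr)
        assume "e \<noteq> y"
        moreover have "(y, e) \<in> ?R" "(e, x) \<in> ?R" "e \<noteq> x"
          using e refl_le le_carrier True disj unfolding le by blast+
        ultimately show False using c by (auto simp: covers_def)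
      qed
      then have "y \<in> T'" using e ET by blast
      then show ?thesis using True disj r(5) by (auto simp: \<rho>'_def)
    next
      case False
      then have xB: "x \<in> B" using yx le le_carrier ET by blast
      then have "(y, x) \<in> R" using yx le_B by simp
      moreover from this have "y \<notin> T" using le_carrier disj by blast
      moreover have "covers R x y"
        using c xB le_B le_carrier unfolding covers_def by metis
      ultimately show ?thesis
        using False rank_covers by (simp add: \<rho>'_def)
    qed
  qed
  moreover have "card {x \<in> B \<union> T. \<rho>' x = m} \<in> S" for m
  proof (cases "m = Suc k")
    case True
    have "{x \<in> B \<union> T. \<rho>' x = m} = T"
      using True by (auto simp: \<rho>'_def split: if_splits dest: rank_le)
    then show ?thesis using T by simp
  next
    case False
    then have "{x \<in> B \<union> T. \<rho>' x = m} = {x \<in> B. \<rho> x = m}"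
      using disj by (auto simp: \<rho>'_def)
    then show ?thesis using r(3) by simp
  qed
  ultimately show ?thesis using r(2) unfolding layered_def by auto
qed

text \<open>The old rank function still works on \<open>B\<close>. The point to check is that the
  maximal elements of \<open>B\<close> are exactly the elements of rank \<open>k\<close>, so that
  \<open>B\<close> is graded again.\<close>

lemma layered_remove_top:
  assumes L: "layered S (Suc k) A T R" and "0 \<in> S"
  defines "B \<equiv> A - T"
  defines "T' \<equiv> {x. maximal_elt B (R \<inter> B \<times> B) x}"
  shows "layered S k B T' (R \<inter> B \<times> B)" "spanning T' T (R \<inter> T' \<times> T)"
    "R = add_top (R \<inter> B \<times> B) (R \<inter> T' \<times> T) T"
proof -
  obtain \<rho> where r: "ranked_poset A R \<rho> (Suc k)" "A \<noteq> {}" "\<forall>m. card {x \<in> A. \<rho> x = m} \<in> S"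
    "T = {x. maximal_elt A R x}" "T = {x \<in> A. \<rho> x = Suc k}" using L by (rule layeredE)
  interpret ranked_poset A R \<rho> "Suc k" by fact
  let ?R = "R \<inter> B \<times> B"
  have B: "B \<subseteq> A" "x \<in> B \<longleftrightarrow> x \<in> A \<and> \<rho> x \<noteq> Suc k" for x
    using r(5) by (auto simp: B_def)
  have down: "x \<in> B" if "(x, y) \<in> R" "y \<in> B" for x y
    using that B le_carrier rank_mono[OF that(1)] rank_le[of y] by force
  have maxT: "y = x" if "x \<in> T" "(x, y) \<in> R" for x y
    using that r(4) by (auto simp: maximal_elt_def)
  interpret B: finite_poset B ?R using B(1) by (rule restrict)
  \<comment> \<open>\<open>B\<close> is a down-set, so an element between two members of
    \<open>B\<close> is in \<open>B\<close>, and covers of the restriction are genuine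
    covers.\<close>
  have cov: "covers R x y" if "covers ?R x y" for x y
    using that down unfolding covers_def by blast
  \<comment> \<open>An element maximal in \<open>B\<close> is not maximal in \<open>A\<close>; each
    of its upper covers escapes \<open>B\<close>, hence lies in \<open>T\<close>, which pins its
    rank to \<open>k\<close>.\<close>
  have up: "\<exists>t\<in>T. covers R t x" if x: "x \<in> T'" for x
  proof -
    have xB: "x \<in> B" and mx: "\<And>y. (x, y) \<in> R \<Longrightarrow> y \<in> B \<Longrightarrow> y = x"
      using x by (auto simp: T'_def maximal_elt_def)
    then have "\<not> maximal_elt A R x" using r(4) by (auto simp: B_def)
    then obtain y where "(x, y) \<in> R" "x \<noteq> y" using xB B(1) by (auto simp: maximal_elt_def)
    then obtain z where z: "covers R z x" by (rule upper_cover_below)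
    then have "z \<notin> B" using mx[of z] coversD[OF z] by auto
    then have "z \<in> T" using coversD(1)[OF z] le_carrier by (auto simp: B_def)
    with z show ?thesis by blast
  qed
  have rkT': "\<rho> x = k" if "x \<in> T'" for x
    using up[OF that] rank_covers r(5) by force
  have rB: "rank_function B ?R \<rho> k"
    unfolding rank_function_def
  proof (intro conjI allI impI)
    fix x assume "minimal_elt B ?R x"
    then have "minimal_elt A R x" using down B by (auto simp: minimal_elt_def)
    then show "\<rho> x = 0" by (rule rank_minimal)
  qed (use rkT' cov rank_covers in \<open>auto simp: T'_def\<close>)
  interpret rB: ranked_poset B ?R \<rho> k using rB by unfold_locales
  have T'I: "x \<in> T'" if "x \<in> A" "\<rho> x = k" for x
    using that rB.rank_eq_top_iff[of x] B(2)[of x] unfolding T'_def by simp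
  have "B \<noteq> {}"
  proof -
    obtain x where x: "minimal_elt A R x" using r(2) minimal_below by blast
    then have "\<rho> x = 0" by (rule rank_minimal)
    then have "x \<in> B" using x B(2) by (auto simp: minimal_elt_def)
    then show ?thesis by blast
  qed
  moreover have "card {x \<in> B. \<rho> x = m} \<in> S" for m
  proof (cases "m = Suc k")
    case True
    then have "{x \<in> B. \<rho> x = m} = {}" using B(2) by auto
    then show ?thesis using \<open>0 \<in> S\<close> by (simp only: card.empty)
  next
    case False
    then have "{x \<in> B. \<rho> x = m} = {x \<in> A. \<rho> x = m}" using B(2) by auto
    then show ?thesis using r(3) by simp
  qed
  ultimately show "layered S k B T' ?R"
    using rB B.finite_poset_axioms unfolding layered_def T'_def by blast
  have TA: "T \<subseteq> A" using r(5) by auto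
  \<comment> \<open>Relations into \<open>T\<close> factor through a lower cover of
    \<open>t\<close>, and such a cover has rank \<open>k\<close>. Hence the edges between the two
    top ranks generate all of them.\<close>
  have low: "\<exists>z\<in>T'. (x, z) \<in> R \<and> (z, t) \<in> R" if t: "t \<in> T" "(x, t) \<in> R" "x \<noteq> t" for x t
  proof -
    obtain z where z: "covers R t z" "(x, z) \<in> R" using t lower_cover_above by metis
    have "\<rho> z = k" using rank_covers[OF z(1)] t r(5) by simp
    then have "z \<in> T'" using T'I le_carrier z(2) by blast
    then show ?thesis using z coversD(1) by blast
  qed
  show "spanning T' T (R \<inter> T' \<times> T)"
    unfolding spanning_def
  proof (intro conjI ballI)
    fix b assume b: "b \<in> T"
    then have "\<not> minimal_elt A R b" using r(5) rank_minimal by force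
    then obtain x where "(x, b) \<in> R" "x \<noteq> b" using b TA by (auto simp: minimal_elt_def)
    then show "\<exists>a. (a, b) \<in> R \<inter> T' \<times> T" using low b by blast
  next
    fix a assume "a \<in> T'"
    then show "\<exists>b. (a, b) \<in> R \<inter> T' \<times> T" using up coversD(1) by blast
  qed simp
  show "R = add_top ?R (R \<inter> T' \<times> T) T"
  proof (intro equalityI subrelI)
    fix x y assume xy: "(x, y) \<in> R"
    show "(x, y) \<in> add_top ?R (R \<inter> T' \<times> T) T"
    proof (cases "y \<in> T")
      case True
      show ?thesis
      proof (cases "x = y")
        case False
        then obtain z where z: "z \<in> T'" "(x, z) \<in> R" "(z, y) \<in> R" using low True xy by blast
        moreover have "z \<in> B" using z by (auto simp: T'_def maximal_elt_def)
        ultimately show ?thesis using down True by (auto simp: add_top_def)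
      qed (use True in \<open>auto simp: add_top_def\<close>)
    next
      case False
      then have "y \<in> B" using le_carrier xy by (auto simp: B_def)
      then show ?thesis using down xy by (auto simp: add_top_def)
    qed
  next
    fix x y assume "(x, y) \<in> add_top ?R (R \<inter> T' \<times> T) T"
    then show "(x, y) \<in> R" using trans_le refl_le TA by (auto simp: add_top_def)
  qed
qed

text \<open>Makes the decomposition unique. Composition with \<open>R\<close> adds no pairs between
  \<open>T'\<close> and \<open>T\<close>, because elements of \<open>T'\<close> are maximal in
  \<open>R\<close> and lie below themselves only.\<close>

lemma add_top_restrict:
  assumes "layered S k B T' R" "E \<subseteq> T' \<times> T" "B \<inter> T = {}"
  shows "add_top R E T \<inter> B \<times> B = R" "add_top R E T \<inter> T' \<times> T = E"
proof -
  interpret finite_poset B R using assms(1) by (simp add: layered_def)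
  have T': "T' = {x. maximal_elt B R x}" using assms(1) by (simp add: layered_def)
  have T'B: "T' \<subseteq> B" unfolding T' by (auto simp: maximal_elt_def)
  show "add_top R E T \<inter> B \<times> B = R"
  proof -
    have "R \<inter> B \<times> B = R" using order_subset by auto
    moreover have "R O E \<inter> B \<times> B = {}" "Id_on T \<inter> B \<times> B = {}" using assms(2,3) by auto
    ultimately show ?thesis by (simp add: add_top_def Int_Un_distrib2)
  qed
  have "R O E \<inter> T' \<times> T = E"
  proof (intro equalityI subrelI)
    fix x y assume "(x, y) \<in> R O E \<inter> T' \<times> T"
    then obtain e where "(x, e) \<in> R" "(e, y) \<in> E" "x \<in> T'" by auto
    then show "(x, y) \<in> E" using T' by (auto simp: maximal_elt_def)
  next
    fix x y assume "(x, y) \<in> E"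
    then show "(x, y) \<in> R O E \<inter> T' \<times> T" using assms(2) T'B refl_le by auto
  qed
  moreover have "R \<inter> T' \<times> T = {}" using order_subset assms(3) by auto
  moreover have "Id_on T \<inter> T' \<times> T = {}" using T'B assms(3) by auto
  ultimately show "add_top R E T \<inter> T' \<times> T = E" by (simp add: add_top_def Int_Un_distrib2)
qed

section \<open>Counting by the size of the top rank\<close>

text \<open>Renaming vertices along \<open>f\<close> and \<open>g\<close> acts injectively on edge
  sets; used in both directions it shows that only the sizes of the two sides matter.\<close>

lemma card_spanning_le:
  assumes f: "bij_betw f X X'" and g: "bij_betw g Y Y'" and fin: "finite X" "finite Y"
  shows "card {E. spanning X Y E} \<le> card {E. spanning X' Y' E}"
proof (rule card_inj_on_le)
  have "finite (Pow (X' \<times> Y'))" using fin bij_betw_finite[OF f] bij_betw_finite[OF g] by simp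
  then show "finite {E. spanning X' Y' E}"
    by (rule finite_subset[rotated]) (auto simp: spanning_def)
  have "inj_on (map_prod f g) (X \<times> Y)"
    using f g by (intro map_prod_inj_on) (auto dest: bij_betw_imp_inj_on)
  then have "inj_on ((`) (map_prod f g)) (Pow (X \<times> Y))" by (rule inj_on_image_Pow)
  then show "inj_on ((`) (map_prod f g)) {E. spanning X Y E}"
    by (rule inj_on_subset) (auto simp: spanning_def)
  show "(`) (map_prod f g) ` {E. spanning X Y E} \<subseteq> {E. spanning X' Y' E}"
  proof (clarsimp simp: spanning_def, intro conjI ballI)
    fix E assume E: "E \<subseteq> X \<times> Y" "\<forall>a\<in>X. \<exists>b. (a, b) \<in> E" "\<forall>b\<in>Y. \<exists>a. (a, b) \<in> E"
    show "map_prod f g ` E \<subseteq> X' \<times> Y'" using E f g by (auto simp: bij_betw_def)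
    show "\<exists>b. (a, b) \<in> map_prod f g ` E" if "a \<in> X'" for a
      using that E f by (force simp: bij_betw_def)
    show "\<exists>a. (a, b) \<in> map_prod f g ` E" if "b \<in> Y'" for b
      using that E g by (force simp: bij_betw_def)
  qed
qed

lemma card_spanning:
  assumes "finite X" "finite Y"
  shows "card {E. spanning X Y E} = psi_s (card X) (card Y)"
proof -
  obtain f g where fg: "bij_betw f X {1..card X}" "bij_betw g Y {1..card Y}"
    using assms finite_same_card_bij[of _ "{1..card _}"] by (metis card_atLeastAtMost diff_Suc_1 finite_atLeastAtMost One_nat_def)
  have "card {E. spanning X Y E} = card {E. spanning {1..card X} {1..card Y} E}"
    using card_spanning_le[OF fg assms]
      card_spanning_le[OF fg[THEN bij_betw_inv_into] finite_atLeastAtMost finite_atLeastAtMost]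
    by (rule antisym)
  then show ?thesis by (simp add: psi_s_def spanning_def)
qed

section \<open>Inclusion-exclusion for bipartite graphs without isolated vertices\<close>

lemma sum_Pow_card:
  assumes "finite A"
  shows "(\<Sum>X\<in>Pow A. f (card X)) = (\<Sum>i\<le>card A. of_nat (card A choose i) * (f i :: 'b :: comm_semiring_1))"
proof -
  have "(\<Sum>X\<in>Pow A. f (card X)) = (\<Sum>i\<le>card A. \<Sum>X\<in>{X. X \<in> Pow A \<and> card X = i}. f (card X))"
    using assms by (intro sum.group[symmetric]) (auto intro: card_mono)
  also have "\<dots> = (\<Sum>i\<le>card A. of_nat (card A choose i) * f i)"
  proof (intro sum.cong refl)
    fix i
    have "(\<Sum>X\<in>{X. X \<in> Pow A \<and> card X = i}. f (card X)) = of_nat (card {X. X \<in> Pow A \<and> card X = i}) * f i"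
      by simp
    then show "(\<Sum>X\<in>{X. X \<in> Pow A \<and> card X = i}. f (card X)) = of_nat (card A choose i) * f i"
      using n_subsets[OF assms, of i] by simp
  qed
  finally show ?thesis .
qed

text \<open>Complementation turns the sum into the alternating sum over all subsets of
  \<open>A - D\<close>, which vanishes unless that set is empty.\<close>

lemma sum_alternating_supersets:
  assumes "finite A" "D \<subseteq> A"
  shows "(\<Sum>X\<in>Pow A. if D \<subseteq> X then (-1) ^ (card A - card X) else 0) = (if D = A then 1 else (0::int))"
proof -
  have cd: "card (A - X) = card A - card X" if "X \<subseteq> A" for X
    using that finite_subset[OF that assms(1)] by (rule card_Diff_subset[rotated])
  have "(\<Sum>X\<in>Pow A. if D \<subseteq> X then (-1) ^ (card A - card X) else 0)
      = (\<Sum>X\<in>{X \<in> Pow A. D \<subseteq> X}. (-1) ^ (card A - card X) :: int)"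
    using assms(1) by (intro sum.inter_filter[symmetric]) simp
  also have "\<dots> = (\<Sum>Y\<in>Pow (A - D). (-1) ^ card Y)"
    by (rule sum.reindex_bij_witness[of _ "\<lambda>Y. A - Y" "\<lambda>X. A - X"])
      (use assms(2) cd in \<open>auto simp: double_diff\<close>)
  also have "\<dots> = (\<Sum>i\<le>card (A - D). (-1) ^ i * int (card (A - D) choose i))"
    using sum_Pow_card[of "A - D" "\<lambda>i. (-1) ^ i :: int"] assms(1) by (simp add: mult.commute)
  also have "\<dots> = (if card (A - D) = 0 then 1 else 0)"
    using choose_alternating_sum[of "card (A - D)", where 'a = int] by auto
  also have "card (A - D) = 0 \<longleftrightarrow> D = A" using assms by auto
  finally show ?thesis .
qed

text \<open>The power \<open>2 ^ (a * b)\<close> counts the graphs living on chosen vertex sets of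
  sizes \<open>a\<close> and \<open>b\<close>. After exchanging the sums, a graph \<open>E\<close>
  is weighted by alternating sums over the supersets of its domain and of its range, and survives
  only if it touches every vertex.\<close>

lemma psi_s_altsum:
  "int (psi_s i j) = (\<Sum>a = 0..i. \<Sum>b = 0..j.
     (-1) ^ ((i - a) + (j - b)) * int (i choose a) * int (j choose b) * 2 ^ (a * b))"
proof -
  define I J where "I = {1..i}" and "J = {1..j}"
  have fin: "finite I" "finite J" and cd: "card I = i" "card J = j" by (auto simp: I_def J_def)
  let ?s = "\<lambda>A X. (-1) ^ (card A - card X) :: int"
  have 2: "card (Pow (X \<times> Y)) = 2 ^ (card X * card Y)" if "X \<in> Pow I" "Y \<in> Pow J" for X Y
  proof -
    have "finite (X \<times> Y)" using that fin finite_subset by blast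
    then show ?thesis by (simp add: card_Pow card_cartesian_product)
  qed
  \<comment> \<open>This separates the conditions on \<open>X\<close> and \<open>Y\<close>, so that
    the double sum for a fixed \<open>E\<close> factors.\<close>
  have split: "E \<in> Pow (X \<times> Y) \<longleftrightarrow> Domain E \<subseteq> X \<and> Range E \<subseteq> Y" for E X Y by fast
  have "(\<Sum>a = 0..i. \<Sum>b = 0..j.
     (-1) ^ ((i - a) + (j - b)) * int (i choose a) * int (j choose b) * 2 ^ (a * b))
    = (\<Sum>a\<le>card I. int (card I choose a) * (\<Sum>b\<le>card J. int (card J choose b) *
        ((-1) ^ (card I - a) * (-1) ^ (card J - b) * 2 ^ (a * b))))"
    by (simp only: cd atLeast0AtMost sum_distrib_left power_add mult_ac)
  also have "\<dots> = (\<Sum>X\<in>Pow I. \<Sum>Y\<in>Pow J. ?s I X * ?s J Y * 2 ^ (card X * card Y))"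
    unfolding sum_Pow_card[OF fin(2), symmetric] sum_Pow_card[OF fin(1), symmetric] by (rule refl)
  also have "\<dots> = (\<Sum>X\<in>Pow I. \<Sum>Y\<in>Pow J. \<Sum>E\<in>Pow (X \<times> Y). ?s I X * ?s J Y)"
    by (intro sum.cong refl) (simp add: 2[symmetric] mult.commute del: card_Pow)
  also have "\<dots> = (\<Sum>X\<in>Pow I. \<Sum>Y\<in>Pow J. \<Sum>E\<in>Pow (I \<times> J). if E \<in> Pow (X \<times> Y) then ?s I X * ?s J Y else 0)"
    using fin by (intro sum.cong refl sum.mono_neutral_cong_left) (auto intro: finite_cartesian_product)
  also have "\<dots> = (\<Sum>X\<in>Pow I. \<Sum>E\<in>Pow (I \<times> J). \<Sum>Y\<in>Pow J. if E \<in> Pow (X \<times> Y) then ?s I X * ?s J Y else 0)"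
    by (intro sum.cong refl sum.swap)
  also have "\<dots> = (\<Sum>E\<in>Pow (I \<times> J). \<Sum>X\<in>Pow I. \<Sum>Y\<in>Pow J. if E \<in> Pow (X \<times> Y) then ?s I X * ?s J Y else 0)"
    by (rule sum.swap)
  also have "\<dots> = (\<Sum>E\<in>Pow (I \<times> J). (\<Sum>X\<in>Pow I. if Domain E \<subseteq> X then ?s I X else 0) *
      (\<Sum>Y\<in>Pow J. if Range E \<subseteq> Y then ?s J Y else 0))"
    unfolding split sum_product by (intro sum.cong refl) auto
  also have "\<dots> = (\<Sum>E\<in>Pow (I \<times> J). if spanning I J E then 1 else 0)"
  proof (intro sum.cong refl)
    fix E assume E: "E \<in> Pow (I \<times> J)"
    then have DR: "Domain E \<subseteq> I" "Range E \<subseteq> J" by auto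
    have "spanning I J E \<longleftrightarrow> Domain E = I \<and> Range E = J"
      using E unfolding spanning_def by fast
    then show "(\<Sum>X\<in>Pow I. if Domain E \<subseteq> X then ?s I X else 0) *
      (\<Sum>Y\<in>Pow J. if Range E \<subseteq> Y then ?s J Y else 0) = (if spanning I J E then 1 else 0)"
      using fin DR by (simp add: sum_alternating_supersets)
  qed
  also have "\<dots> = int (card {E \<in> Pow (I \<times> J). spanning I J E})"
    using fin by (simp add: sum.inter_filter[symmetric])
  also have "{E \<in> Pow (I \<times> J). spanning I J E} = {E. spanning I J E}"
    by (auto simp: spanning_def)
  also have "card \<dots> = psi_s i j" using card_spanning[OF fin] cd by simp
  finally show ?thesis ..
qed

text \<open>Counts the orders on \<open>n\<close> points whose top rank is a fixed set of
  \<open>t\<close> points. In the recursion \<open>s\<close> is the size of the rank below, to be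
  chosen among the \<open>n - t\<close> remaining points.\<close>

fun layer_count :: "nat set \<Rightarrow> nat \<Rightarrow> nat \<Rightarrow> nat \<Rightarrow> nat" where
  "layer_count S 0 n t = (if n = t \<and> 0 < t \<and> t \<in> S then 1 else 0)"
| "layer_count S (Suc k) n t = (if 0 < t \<and> t \<le> n \<and> t \<in> S then
     \<Sum>s\<le>n - t. (n - t choose s) * (layer_count S k (n - t) s * psi_s s t) else 0)"

lemma layer_count_eq_0:
  "layer_count S k n 0 = 0"
  "n < t \<Longrightarrow> layer_count S k n t = 0"
  "t \<notin> S \<Longrightarrow> layer_count S k n t = 0"
  by (cases k; auto)+

text \<open>Each of the \<open>k + 1\<close> ranks needs a point. This bounds the heights to be
  summed and later supplies divisibility by \<open>fps_X ^ k\<close>.\<close>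

lemma layer_count_height: "n \<le> k \<Longrightarrow> layer_count S k n t = 0"
proof (induction k arbitrary: n t)
  case (Suc k)
  then have "layer_count S k (n - t) s = 0" if "0 < t" for s
    using that by (cases "n = 0") (auto intro: Suc.IH layer_count_eq_0)
  then show ?case by simp
qed auto

lemma layered_top: "layered S k A T R \<Longrightarrow> T \<subseteq> A \<and> T \<noteq> {}"
proof (elim layeredE)
  fix \<rho> assume r: "ranked_poset A R \<rho> k" "A \<noteq> {}" "T = {x. maximal_elt A R x}"
  interpret ranked_poset A R \<rho> k by fact
  obtain x where "maximal_elt A R x" using r(2) maximal_above by blast
  then show "T \<subseteq> A \<and> T \<noteq> {}" using r(3) by (auto simp: maximal_elt_def)
qed

lemma layered_finite: "layered S k A T R \<Longrightarrow> finite A"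
  by (simp add: layered_def finite_poset_def)

lemma layered_subset: "layered S k A T R \<Longrightarrow> R \<in> Pow (A \<times> A)"
  by (simp add: layered_def finite_poset.order_subset)

lemma finite_layered: "finite A \<Longrightarrow> finite {R. layered S k A T R}"
  by (rule finite_subset[of _ "Pow (A \<times> A)"]) (blast dest: layered_subset, simp)

lemma card_layered_Suc:
  assumes A: "finite A" and T: "T \<subseteq> A" "T \<noteq> {}" "card T \<in> S" and "0 \<in> S"
  shows "card {R. layered S (Suc k) A T R} =
    (\<Sum>T'\<in>Pow (A - T). card {R. layered S k (A - T) T' R} * psi_s (card T') (card T))"
proof -
  let ?B = "A - T"
  let ?D = "Sigma (Pow ?B) (\<lambda>T'. {R. layered S k ?B T' R} \<times> {E. spanning T' T E})"
  let ?f = "\<lambda>(T', R, E). add_top R E T"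
  have finT: "finite T" using A T finite_subset by blast
  have "{R. layered S (Suc k) A T R} = ?f ` ?D"
  proof (intro equalityI subsetI)
    fix R assume "R \<in> {R. layered S (Suc k) A T R}"
    then have L: "layered S (Suc k) A T R" by simp
    note rem = layered_remove_top[OF L \<open>0 \<in> S\<close>]
    let ?R = "R \<inter> ?B \<times> ?B"
    let ?T = "{x. maximal_elt ?B ?R x}"
    have "R = ?f (?T, ?R, R \<inter> ?T \<times> T)" using rem(3) by (simp only: prod.case)
    moreover have "(?T, ?R, R \<inter> ?T \<times> T) \<in> ?D"
      using rem(1,2) layered_top[OF rem(1)] by blast
    ultimately show "R \<in> ?f ` ?D" by (rule image_eqI)
  next
    fix R assume "R \<in> ?f ` ?D"
    then obtain T' R' E where "layered S k ?B T' R'" "spanning T' T E" "R = add_top R' E T" by auto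
    then show "R \<in> {R. layered S (Suc k) A T R}"
      using layered_add_top[of S k ?B T' R' T E] finT T \<open>0 \<in> S\<close>
      by (simp add: Un_absorb2 Int_commute[of _ T])
  qed
  \<comment> \<open>\<open>R\<close> is recovered by restriction to \<open>?B\<close>, then
    \<open>T'\<close> as its set of maximal elements, and then \<open>E\<close> by restriction to
    \<open>T' \<times> T\<close>.\<close>
  moreover have "inj_on ?f ?D"
  proof (rule inj_onI)
    fix p q assume p: "p \<in> ?D" and q: "q \<in> ?D" and f: "?f p = ?f q"
    obtain T1 R1 E1 T2 R2 E2 where pq: "p = (T1, R1, E1)" "q = (T2, R2, E2)"
      by (metis prod_cases3)
    have 1: "layered S k ?B T1 R1" "spanning T1 T E1"
      and 2: "layered S k ?B T2 R2" "spanning T2 T E2"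
      and eq: "add_top R1 E1 T = add_top R2 E2 T"
      using p q f unfolding pq by auto
    note r1 = add_top_restrict[OF 1(1), of E1 T] and r2 = add_top_restrict[OF 2(1), of E2 T]
    have R: "R1 = R2" using r1(1) r2(1) 1(2) 2(2) eq by (auto simp: spanning_def)
    then have T: "T1 = T2" using 1(1) 2(1) by (simp add: layered_def)
    have "E1 = E2" using r1(2) r2(2) 1(2) 2(2) eq T by (auto simp: spanning_def)
    with R T show "p = q" unfolding pq by blast
  qed
  ultimately have "card {R. layered S (Suc k) A T R} = card ?D" by (simp add: card_image)
  also have "\<dots> = (\<Sum>T'\<in>Pow ?B. card {R. layered S k ?B T' R} * card {E. spanning T' T E})"
    unfolding card_cartesian_product[symmetric]
  proof (rule card_SigmaI)
    show "\<forall>T'\<in>Pow ?B. finite ({R. layered S k ?B T' R} \<times> {E. spanning T' T E})"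
    proof
      fix T' assume "T' \<in> Pow ?B"
      then have "finite T'" using A finite_subset by blast
      then have "finite (Pow (T' \<times> T))" using finT by simp
      then have "finite {E. spanning T' T E}"
        by (rule finite_subset[rotated]) (auto simp: spanning_def)
      then show "finite ({R. layered S k ?B T' R} \<times> {E. spanning T' T E})"
        using A finite_layered by blast
    qed
  qed (use A in simp)
  also have "\<dots> = (\<Sum>T'\<in>Pow ?B. card {R. layered S k ?B T' R} * psi_s (card T') (card T))"
  proof (intro sum.cong refl)
    fix T' assume "T' \<in> Pow ?B"
    then have "finite T'" using A finite_subset by blast
    then show "card {R. layered S k ?B T' R} * card {E. spanning T' T E} =
        card {R. layered S k ?B T' R} * psi_s (card T') (card T)"
      by (simp only: card_spanning[OF _ finT])
  qed
  finally show ?thesis .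
qed

lemma card_layered:
  assumes "finite A" "T \<subseteq> A" "0 \<in> S"
  shows "card {R. layered S k A T R} = layer_count S k (card A) (card T)"
  using assms
proof (induction k arbitrary: A T)
  case 0
  have fT: "finite T" using 0 finite_subset by blast
  have eq: "card A = card T \<longleftrightarrow> T = A" using 0 card_subset_eq by metis
  have "{R. layered S 0 A T R} = (if T = A \<and> A \<noteq> {} \<and> card A \<in> S then {Id_on A} else {})"
    using layered_0_iff[OF 0(3), of A T] 0(1) by auto
  then show ?case using eq fT by (auto simp: card_gt_0_iff)
next
  case (Suc k)
  have fT: "finite T" using Suc.prems finite_subset by blast
  show ?case
  proof (cases "T \<noteq> {} \<and> card T \<in> S")
    case True
    have "card {R. layered S (Suc k) A T R} =
      (\<Sum>T'\<in>Pow (A - T). card {R. layered S k (A - T) T' R} * psi_s (card T') (card T))"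
      using True Suc.prems by (intro card_layered_Suc) auto
    also have "\<dots> = (\<Sum>T'\<in>Pow (A - T). layer_count S k (card (A - T)) (card T') * psi_s (card T') (card T))"
      using Suc.prems by (intro sum.cong refl) (simp add: Suc.IH)
    also have "\<dots> = (\<Sum>s\<le>card (A - T). (card (A - T) choose s) *
        (layer_count S k (card (A - T)) s * psi_s s (card T)))"
      using Suc.prems by (subst sum_Pow_card) auto
    finally show ?thesis
      using True Suc.prems fT by (simp add: card_Diff_subset card_gt_0_iff card_mono)
  next
    case False
    then have "{R. layered S (Suc k) A T R} = {}"
      using layered_top layered_card_top by blast
    then show ?thesis using False fT by (simp only: card.empty) auto
  qed
qed

lemma layered_top_unique: "layered S k A T R \<Longrightarrow> layered S k A T' R \<Longrightarrow> T = T'"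
  by (simp add: layered_def)

lemma card_layered_any:
  assumes "finite A" "0 \<in> S"
  shows "card {R. \<exists>T. layered S k A T R} =
    (\<Sum>t\<le>card A. (card A choose t) * layer_count S k (card A) t)"
proof -
  have "T \<in> Pow A" if "layered S k A T R" for T R
    using layered_top[OF that] by simp
  then have "{R. \<exists>T. layered S k A T R} = (\<Union>T\<in>Pow A. {R. layered S k A T R})" by blast
  also have "card \<dots> = (\<Sum>T\<in>Pow A. card {R. layered S k A T R})"
  proof (intro card_UN_disjoint ballI impI)
    show "{R. layered S k A T R} \<inter> {R. layered S k A T' R} = {}" if "T \<noteq> T'" for T T'
      using that layered_top_unique by blast
  qed (use assms(1) in \<open>simp_all add: finite_layered\<close>)
  also have "\<dots> = (\<Sum>T\<in>Pow A. layer_count S k (card A) (card T))"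
    using assms by (intro sum.cong refl card_layered) auto
  also have "\<dots> = (\<Sum>t\<le>card A. (card A choose t) * layer_count S k (card A) t)"
    using assms(1) by (subst sum_Pow_card) auto
  finally show ?thesis .
qed

lemma layered_height_unique:
  assumes "layered S k A T R" "rank_function A R \<rho> M"
  shows "M = k"
proof -
  obtain \<rho>' where "ranked_poset A R \<rho>' k" "A \<noteq> {}" using assms(1) by (rule layeredE)
  then show ?thesis using ranked_poset.top_unique assms(2) by metis
qed

text \<open>Read off from the counting: when \<open>k\<close> is at least the number of points, the
  count is 0 and the finite set of such orders is empty.\<close>

lemma layered_height_less:
  assumes "layered S k A T R" "0 \<in> S"
  shows "k < card A"
proof (rule ccontr)
  have fin: "finite A" "T \<subseteq> A" using assms layered_finite layered_top by blast+
  assume "\<not> k < card A"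
  then have "card {R. layered S k A T R} = 0"
    using fin assms(2) by (simp add: card_layered layer_count_height)
  then have "{R. layered S k A T R} = {}" by (simp add: finite_layered[OF fin(1)])
  then show False using assms(1) by blast
qed

lemma card_layered_all:
  assumes "finite A" "0 \<in> S"
  shows "card {R. \<exists>k T. layered S k A T R} =
    (\<Sum>k<card A. \<Sum>t\<le>card A. (card A choose t) * layer_count S k (card A) t)"
proof -
  have "{R. \<exists>k T. layered S k A T R} = (\<Union>k<card A. {R. \<exists>T. layered S k A T R})"
    using layered_height_less assms by blast
  also have "card \<dots> = (\<Sum>k<card A. card {R. \<exists>T. layered S k A T R})"
  proof (intro card_UN_disjoint ballI impI)
    show "finite {R. \<exists>T. layered S k A T R}" for k
      by (rule finite_subset[of _ "Pow (A \<times> A)"])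
        (blast dest: layered_subset, simp add: assms(1))
    show "{R. \<exists>T. layered S k A T R} \<inter> {R. \<exists>T. layered S l A T R} = {}" if "k \<noteq> l" for k l
    proof -
      have False if "layered S k A T R" "layered S l A T' R" for R T T'
        using that layered_height_unique[of S l A T' R] \<open>k \<noteq> l\<close> by (auto simp: layered_def[of S k])
      then show ?thesis by blast
    qed
  qed simp
  finally show ?thesis using assms by (simp add: card_layered_any)
qed

lemma layered_atMost_iff:
  "(\<exists>k T. layered {..r} k A T R) \<longleftrightarrow> graded_poset A R \<and> ranks_at_most A R r"
  by (auto simp: layered_def graded_poset_iff ranks_at_most_def)

lemma layered_UNIV_iff: "(\<exists>k T. layered UNIV k A T R) \<longleftrightarrow> graded_poset A R"
  by (auto simp: layered_def graded_poset_iff)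

text \<open>Height \<open>k\<close> means top rank \<open>k - 1\<close>; the bound
  \<open>1 \<le> k\<close> keeps truncated subtraction from confusing heights 0 and 1.\<close>

lemma layered_atMost_height_iff:
  assumes "1 \<le> k"
  shows "(\<exists>T. layered {..r} (k - 1) A T R) \<longleftrightarrow>
    graded_poset A R \<and> has_height A R k \<and> ranks_at_most A R r"
proof
  assume L: "\<exists>T. layered {..r} (k - 1) A T R"
  then obtain \<rho> where "rank_function A R \<rho> (k - 1)" unfolding layered_def by blast
  then have "has_height A R k"
    unfolding has_height_def using assms le_add_diff_inverse2 by metis
  with L show "graded_poset A R \<and> has_height A R k \<and> ranks_at_most A R r"
    using layered_atMost_iff by blast
next
  assume a: "graded_poset A R \<and> has_height A R k \<and> ranks_at_most A R r"
  then obtain l T where l: "layered {..r} l A T R" using layered_atMost_iff by blast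
  obtain \<rho> M where "rank_function A R \<rho> M" "k = M + 1" using a by (auto simp: has_height_def)
  with l have "l = k - 1" using layered_height_unique by fastforce
  with l show "\<exists>T. layered {..r} (k - 1) A T R" by blast
qed

lemma num_graded_rk_eq:
  "1 \<le> k \<Longrightarrow> num_graded_rk n r k = (\<Sum>t\<le>n. (n choose t) * layer_count {..r} (k - 1) n t)"
  using card_layered_any[of "{1..n}" "{..r}" "k - 1"]
  by (simp add: num_graded_rk_def layered_atMost_height_iff[symmetric] del: One_nat_def)

lemma num_graded_r_eq:
  "num_graded_r n r = (\<Sum>k<n. \<Sum>t\<le>n. (n choose t) * layer_count {..r} k n t)"
  using card_layered_all[of "{1..n}" "{..r}"]
  by (simp add: num_graded_r_def layered_atMost_iff[symmetric])

lemma num_graded_eq: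
  "num_graded n = (\<Sum>k<n. \<Sum>t\<le>n. (n choose t) * layer_count UNIV k n t)"
  using card_layered_all[of "{1..n}" UNIV]
  by (simp add: num_graded_def layered_UNIV_iff[symmetric])

section \<open>Infinite matrices of formal power series\<close>

text \<open>Divisibility by powers of \<open>fps_X\<close> is the measure of convergence from here
  on: if term \<open>k\<close> is divisible by \<open>fps_X ^ k\<close>, only finitely many terms
  reach a given coefficient.\<close>

lemma fps_X_power_dvd_iff: "fps_X ^ k dvd F \<longleftrightarrow> (\<forall>n<k. F $ n = 0)" for F :: "'a :: comm_ring_1 fps"
proof
  assume "fps_X ^ k dvd F"
  then show "\<forall>n<k. F $ n = 0" by (auto elim!: dvdE simp: fps_X_power_mult_nth)
next
  assume "\<forall>n<k. F $ n = 0"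
  then have "F = fps_X ^ k * Abs_fps (\<lambda>n. F $ (n + k))"
    by (auto simp: fps_eq_iff fps_X_power_mult_nth)
  then show "fps_X ^ k dvd F" by (rule dvdI)
qed

lemma fps_eq_0_if_dvd:
  fixes F :: "'a :: comm_ring_1 fps"
  assumes "\<And>k. fps_X ^ k dvd F"
  shows "F = 0"
  using assms fps_X_power_dvd_iff by (metis fps_eq_iff fps_zero_nth lessI)

lemma fps_sums_iff:
  "f sums (F :: 'a :: comm_ring_1 fps) \<longleftrightarrow> (\<forall>n. eventually (\<lambda>m. (\<Sum>k<m. f k $ n) = F $ n) sequentially)"
  by (simp add: sums_def tendsto_fps_iff fps_sum_nth)

lemma fps_sums_add:
  fixes f g :: "nat \<Rightarrow> 'a :: comm_ring_1 fps"
  assumes "f sums F" "g sums G"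
  shows "(\<lambda>k. f k + g k) sums (F + G)"
  unfolding fps_sums_iff
proof
  fix n
  show "eventually (\<lambda>m. (\<Sum>k<m. (f k + g k) $ n) = (F + G) $ n) sequentially"
    using assms[unfolded fps_sums_iff, rule_format, of n]
    by eventually_elim (simp add: sum.distrib)
qed

lemma fps_sums_diff:
  fixes f g :: "nat \<Rightarrow> 'a :: comm_ring_1 fps"
  assumes "f sums F" "g sums G"
  shows "(\<lambda>k. f k - g k) sums (F - G)"
  unfolding fps_sums_iff
proof
  fix n
  show "eventually (\<lambda>m. (\<Sum>k<m. (f k - g k) $ n) = (F - G) $ n) sequentially"
    using assms[unfolded fps_sums_iff, rule_format, of n]
    by eventually_elim (simp add: sum_subtractf)
qed

lemma fps_sums_dvd:
  fixes f :: "nat \<Rightarrow> 'a :: comm_ring_1 fps"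
  assumes "\<And>k. fps_X ^ k dvd f k"
  shows "f sums Abs_fps (\<lambda>n. \<Sum>k\<le>n. f k $ n)"
  unfolding fps_sums_iff
proof
  fix n
  have z: "f k $ n = 0" if "n < k" for k
    using assms[of k] that by (simp add: fps_X_power_dvd_iff)
  show "eventually (\<lambda>m. (\<Sum>k<m. f k $ n) = Abs_fps (\<lambda>n. \<Sum>k\<le>n. f k $ n) $ n) sequentially"
    using eventually_gt_at_top[of n]
  proof eventually_elim
    case (elim m)
    then have "(\<Sum>k<m. f k $ n) = (\<Sum>k\<le>n. f k $ n)"
      using z by (intro sum.mono_neutral_right) auto
    then show ?case by simp
  qed
qed

lemma fps_summable:
  fixes f :: "nat \<Rightarrow> 'a :: comm_ring_1 fps"
  shows "(\<And>k. fps_X ^ k dvd f k) \<Longrightarrow> summable f"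
  by (rule sums_summable[OF fps_sums_dvd])

lemma fps_sums_suminf:
  fixes f :: "nat \<Rightarrow> 'a :: comm_ring_1 fps"
  shows "(\<And>k. fps_X ^ k dvd f k) \<Longrightarrow> f sums (\<Sum>k. f k)"
  by (rule summable_sums[OF fps_summable])

text \<open>Any truncation \<open>m \<ge> n\<close> will do, so coefficients of different degrees,
  or nested sums, can share one finite range.\<close>

lemma fps_suminf_nth:
  fixes f :: "nat \<Rightarrow> 'a :: comm_ring_1 fps"
  assumes "\<And>k. fps_X ^ k dvd f k" "n \<le> m"
  shows "(\<Sum>k. f k) $ n = (\<Sum>k\<le>m. f k $ n)"
proof -
  have z: "f k $ n = 0" if "n < k" for k
    using assms(1)[of k] that by (simp add: fps_X_power_dvd_iff)
  have "(\<Sum>k. f k) $ n = (\<Sum>k\<le>n. f k $ n)"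
    using sums_unique[OF fps_sums_dvd[of f], symmetric] assms(1) by simp
  also have "\<dots> = (\<Sum>k\<le>m. f k $ n)"
    using assms(2) z by (intro sum.mono_neutral_left) auto
  finally show ?thesis .
qed

lemma fps_suminf_add:
  fixes f g :: "nat \<Rightarrow> 'a :: comm_ring_1 fps"
  assumes "\<And>k. fps_X ^ k dvd f k" "\<And>k. fps_X ^ k dvd g k"
  shows "(\<Sum>k. f k + g k) = (\<Sum>k. f k) + (\<Sum>k. g k)"
  using assms by (intro sums_unique[symmetric] fps_sums_add fps_sums_suminf)

lemma fps_suminf_diff:
  fixes f g :: "nat \<Rightarrow> 'a :: comm_ring_1 fps"
  assumes "\<And>k. fps_X ^ k dvd f k" "\<And>k. fps_X ^ k dvd g k"
  shows "(\<Sum>k. f k - g k) = (\<Sum>k. f k) - (\<Sum>k. g k)"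
  using assms by (intro sums_unique[symmetric] fps_sums_diff fps_sums_suminf)

lemma fps_suminf_mult_left:
  fixes f :: "nat \<Rightarrow> 'a :: comm_ring_1 fps"
  assumes "\<And>k. fps_X ^ k dvd f k"
  shows "(\<Sum>k. c * f k) = c * (\<Sum>k. f k)"
proof (rule fps_ext)
  fix n
  have "(\<Sum>k. c * f k) $ n = (\<Sum>k\<le>n. (c * f k) $ n)"
    using assms by (intro fps_suminf_nth) auto
  also have "\<dots> = (c * (\<Sum>k\<le>n. f k)) $ n" by (simp add: sum_distrib_left fps_sum_nth)
  also have "\<dots> = (\<Sum>i=0..n. c $ i * (\<Sum>k\<le>n. f k $ (n - i)))"
    by (simp add: fps_mult_nth fps_sum_nth)
  also have "\<dots> = (\<Sum>i=0..n. c $ i * (\<Sum>k. f k) $ (n - i))"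
    using assms by (intro sum.cong refl) (simp add: fps_suminf_nth[of f _ n])
  finally show "(\<Sum>k. c * f k) $ n = (c * (\<Sum>k. f k)) $ n" by (simp add: fps_mult_nth)
qed

lemma fps_suminf_mult_right:
  fixes f :: "nat \<Rightarrow> 'a :: comm_ring_1 fps"
  assumes "\<And>k. fps_X ^ k dvd f k"
  shows "(\<Sum>k. f k * c) = (\<Sum>k. f k) * c"
  using fps_suminf_mult_left[OF assms, of c] by (simp add: mult.commute)

lemma fps_dvd_suminf:
  fixes f :: "nat \<Rightarrow> 'a :: comm_ring_1 fps"
  assumes "\<And>k. fps_X ^ k dvd f k" "\<And>k. fps_X ^ m dvd f k"
  shows "fps_X ^ m dvd (\<Sum>k. f k)"
  unfolding fps_X_power_dvd_iff
proof (intro allI impI)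
  fix n assume "n < m"
  then show "(\<Sum>k. f k) $ n = 0"
    using assms(2) fps_suminf_nth[OF assms(1) order_refl, of n] by (simp add: fps_X_power_dvd_iff)
qed

text \<open>With decay in both indices, coefficient \<open>n\<close> on either side is a finite sum
  over the same square of indices up to \<open>n\<close>.\<close>

lemma fps_suminf_swap:
  fixes f :: "nat \<Rightarrow> nat \<Rightarrow> 'a :: comm_ring_1 fps"
  assumes "\<And>k l. fps_X ^ k dvd f k l" "\<And>k l. fps_X ^ l dvd f k l"
  shows "(\<Sum>k. \<Sum>l. f k l) = (\<Sum>l. \<Sum>k. f k l)"
proof (rule fps_ext)
  fix n
  have "(\<Sum>k. \<Sum>l. f k l) $ n = (\<Sum>k\<le>n. \<Sum>l\<le>n. f k l $ n)"
    using assms by (simp add: fps_suminf_nth[of _ n n] fps_dvd_suminf)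
  also have "\<dots> = (\<Sum>l\<le>n. \<Sum>k\<le>n. f k l $ n)" by (rule sum.swap)
  also have "\<dots> = (\<Sum>l. \<Sum>k. f k l) $ n"
    using assms by (simp add: fps_suminf_nth[of _ n n] fps_dvd_suminf)
  finally show "(\<Sum>k. \<Sum>l. f k l) $ n = (\<Sum>l. \<Sum>k. f k l) $ n" .
qed

lemma fps_suminf_split_head:
  fixes f :: "nat \<Rightarrow> 'a :: comm_ring_1 fps"
  assumes "\<And>k. fps_X ^ k dvd f k"
  shows "(\<Sum>k. f k) = f 0 + (\<Sum>k. f (Suc k))"
proof (rule fps_ext)
  fix n
  have "fps_X ^ k dvd f (Suc k)" for k
    using assms[of "Suc k"] by (auto intro: dvd_trans simp: le_imp_power_dvd)
  then have "(\<Sum>k. f (Suc k)) $ n = (\<Sum>k\<le>n. f (Suc k) $ n)" by (intro fps_suminf_nth) auto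
  moreover have "(\<Sum>k. f k) $ n = (\<Sum>k\<le>Suc n. f k $ n)"
    using assms by (intro fps_suminf_nth) auto
  ultimately show "(\<Sum>k. f k) $ n = (f 0 + (\<Sum>k. f (Suc k))) $ n"
    by (simp only: sum.atMost_Suc_shift fps_add_nth)
qed

lemma fps_suminf_compose:
  fixes f :: "nat \<Rightarrow> real fps"
  assumes "\<And>k. fps_X ^ k dvd f k"
  shows "(\<Sum>k. f k) oo fps_X ^ 2 = (\<Sum>k. f k oo fps_X ^ 2)"
    and "\<And>k. fps_X ^ k dvd f k oo fps_X ^ 2"
proof -
  show d: "fps_X ^ k dvd f k oo fps_X ^ 2" for k
    using assms[of k] by (auto simp: fps_X_power_dvd_iff fps_nth_compose_X_power)
  show "(\<Sum>k. f k) oo fps_X ^ 2 = (\<Sum>k. f k oo fps_X ^ 2)"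
  proof (rule fps_ext)
    fix n
    have "(\<Sum>k. f k oo fps_X ^ 2) $ n = (\<Sum>k\<le>n. (f k oo fps_X ^ 2) $ n)"
      using d by (intro fps_suminf_nth) auto
    moreover have "(\<Sum>k. f k) $ (n div 2) = (\<Sum>k\<le>n. f k $ (n div 2))"
      using assms by (intro fps_suminf_nth) auto
    ultimately show "((\<Sum>k. f k) oo fps_X ^ 2) $ n = (\<Sum>k. f k oo fps_X ^ 2) $ n"
      by (simp add: fps_nth_compose_X_power)
  qed
qed

section \<open>Products of infinite matrices and the inverse of I - N\<close>

lemma sums_delta_left:
  "(\<lambda>k. (if i = k then 1 else 0) * F k) sums (F i :: real fps)"
  using sums_single[of i F] by (simp add: if_distrib[of "\<lambda>x. x * _"] eq_commute cong: if_cong)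

lemma sums_delta_right:
  "(\<lambda>k. F k * (if k = j then 1 else 0)) sums (F j :: real fps)"
  using sums_single[of j F] by (simp add: if_distrib cong: if_cong)

text \<open>Decay along row \<open>i\<close> of \<open>A\<close> and down column \<open>j\<close> of
  \<open>C\<close> allows the double sum to be exchanged, whatever the middle factor is.\<close>

lemma imat_mult_assoc:
  assumes A: "\<And>k. fps_X ^ k dvd A i k" and C: "\<And>l. fps_X ^ l dvd C l j"
  shows "(A **\<^sub>\<infinity> B **\<^sub>\<infinity> C) i j = (A **\<^sub>\<infinity> (B **\<^sub>\<infinity> C)) i j"
proof -
  have "(A **\<^sub>\<infinity> B **\<^sub>\<infinity> C) i j = (\<Sum>l. \<Sum>k. A i k * B k l * C l j)"
    unfolding imat_mult_def using A by (subst fps_suminf_mult_right) auto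
  also have "\<dots> = (\<Sum>k. \<Sum>l. A i k * B k l * C l j)"
    using A C by (intro fps_suminf_swap) auto
  also have "\<dots> = (\<Sum>k. \<Sum>l. A i k * (B k l * C l j))" by (simp add: mult.assoc)
  also have "\<dots> = (A **\<^sub>\<infinity> (B **\<^sub>\<infinity> C)) i j"
    unfolding imat_mult_def using C by (subst fps_suminf_mult_left) auto
  finally show ?thesis .
qed

text \<open>The growth in \<open>i\<close> and \<open>j\<close> makes sums along rows and columns
  converge; the extra factor \<open>fps_X\<close> makes multiplication by \<open>N\<close> gain one
  order of divisibility.\<close>

locale contraction =
  fixes N :: "nat \<Rightarrow> nat \<Rightarrow> real fps"
  assumes dvd_N: "fps_X ^ Suc (i + j) dvd N i j"
begin

lemma dvd_N': "fps_X ^ i dvd N i j" "fps_X ^ j dvd N i j" "fps_X dvd N i j"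
proof -
  have "fps_X ^ i dvd (fps_X ^ Suc (i + j) :: real fps)"
    "fps_X ^ j dvd (fps_X ^ Suc (i + j) :: real fps)" "fps_X ^ 1 dvd (fps_X ^ Suc (i + j) :: real fps)"
    by (rule le_imp_power_dvd; simp)+
  then show "fps_X ^ i dvd N i j" "fps_X ^ j dvd N i j" "fps_X dvd N i j"
    using dvd_N[of i j] by (auto intro: dvd_trans simp del: power_Suc)
qed

text \<open>Each application of \<open>N\<close> gains a factor \<open>fps_X\<close>, so a fixed
  point is divisible by all its powers. Convergence comes from the decay of \<open>N\<close> alone,
  so \<open>Z\<close> may be arbitrary.\<close>

lemma fixpoint_eq_0:
  assumes "\<And>i j. Z i j = (N **\<^sub>\<infinity> Z) i (j :: 'j)"
  shows "Z i j = 0"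
proof (rule fps_eq_0_if_dvd)
  fix m
  show "fps_X ^ m dvd Z i j"
  proof (induction m arbitrary: i j)
    case (Suc m)
    have "fps_X ^ Suc m dvd (\<Sum>k. N i k * Z k j)"
    proof (rule fps_dvd_suminf)
      show "fps_X ^ k dvd N i k * Z k j" for k using dvd_N'(2) by (rule dvd_mult2)
      show "fps_X ^ Suc m dvd N i k * Z k j" for k
        unfolding power_Suc using dvd_N'(3) Suc.IH by (rule mult_dvd_mono)
    qed
    then show ?case using assms[of i j] by (simp add: imat_mult_def)
  qed simp
qed

text \<open>\<open>N_pow m\<close> is the power \<open>m + 1\<close> of \<open>N\<close>. The
  identity is left out because its diagonal entries are 1 and would violate the estimate
  \<open>dvd_N_pow\<close>.\<close>

primrec N_pow :: "nat \<Rightarrow> nat \<Rightarrow> nat \<Rightarrow> real fps" where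
  "N_pow 0 = N"
| "N_pow (Suc m) = N **\<^sub>\<infinity> N_pow m"

text \<open>The Neumann series without its identity term.\<close>

definition Q :: "nat \<Rightarrow> nat \<Rightarrow> real fps" where
  "Q i j = (\<Sum>m. N_pow m i j)"

text \<open>The part \<open>m\<close> makes the series over powers converge, the part
  \<open>i\<close> makes its sum decay down columns. In the induction step the product has exponent
  \<open>Suc m + i + 2 * k\<close>, more than is asked for.\<close>

lemma dvd_N_pow: "fps_X ^ (m + i) dvd N_pow m i j"
proof (induction m arbitrary: i)
  case 0
  then show ?case using dvd_N' by simp
next
  case (Suc m)
  have "fps_X ^ (Suc m + i) dvd (\<Sum>k. N i k * N_pow m k j)"
  proof (rule fps_dvd_suminf)
    show "fps_X ^ k dvd N i k * N_pow m k j" for k using dvd_N'(2) by (rule dvd_mult2)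
    show "fps_X ^ (Suc m + i) dvd N i k * N_pow m k j" for k
    proof (rule dvd_trans)
      show "fps_X ^ (Suc (i + k) + (m + k)) dvd N i k * N_pow m k j"
        unfolding power_add[of _ "Suc (i + k)"] using dvd_N Suc.IH by (rule mult_dvd_mono)
    qed (rule le_imp_power_dvd, simp)
  qed
  then show ?case by (simp add: imat_mult_def)
qed

lemma dvd_N_pow': "fps_X ^ m dvd N_pow m i j" "fps_X ^ i dvd N_pow m i j"
  using dvd_N_pow[of m i j] by (auto simp: power_add dest: dvd_mult_left dvd_mult_right)

lemma dvd_Q: "fps_X ^ i dvd Q i j"
  unfolding Q_def using dvd_N_pow' by (intro fps_dvd_suminf)

lemma Q_right: "Q i j = N i j + (N **\<^sub>\<infinity> Q) i j"
proof -
  have "(N **\<^sub>\<infinity> Q) i j = (\<Sum>k. \<Sum>m. N i k * N_pow m k j)"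
    unfolding imat_mult_def Q_def using dvd_N_pow' by (subst fps_suminf_mult_left) auto
  also have "\<dots> = (\<Sum>m. \<Sum>k. N i k * N_pow m k j)"
    using dvd_N_pow' dvd_N' by (intro fps_suminf_swap) auto
  also have "\<dots> = (\<Sum>m. N_pow (Suc m) i j)" by (simp add: imat_mult_def)
  finally show ?thesis
    using fps_suminf_split_head[of "\<lambda>m. N_pow m i j"] dvd_N_pow' by (simp add: Q_def)
qed

text \<open>Substituting Q = N + NQ shows that QN and NQ both solve Y = NN + NY, so their difference
  is a fixed point of multiplication by \<open>N\<close>.\<close>

lemma Q_commute: "(Q **\<^sub>\<infinity> N) i j = (N **\<^sub>\<infinity> Q) i j"
proof -
  define Z where "Z i j = (Q **\<^sub>\<infinity> N) i j - (N **\<^sub>\<infinity> Q) i j" for i j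
  have "Z i j = (N **\<^sub>\<infinity> Z) i j" for i j
  proof -
    have "(Q **\<^sub>\<infinity> N) i j = (\<Sum>k. N i k * N k j + (N **\<^sub>\<infinity> Q) i k * N k j)"
      unfolding imat_mult_def[of Q N] by (subst Q_right) (simp add: algebra_simps)
    also have "\<dots> = (\<Sum>k. N i k * N k j) + (N **\<^sub>\<infinity> Q **\<^sub>\<infinity> N) i j"
      unfolding imat_mult_def[of "N **\<^sub>\<infinity> Q"] using dvd_N' by (intro fps_suminf_add) auto
    also have "(N **\<^sub>\<infinity> Q **\<^sub>\<infinity> N) i j = (\<Sum>k. N i k * (Q **\<^sub>\<infinity> N) k j)"
      using dvd_N' by (subst imat_mult_assoc) (auto simp: imat_mult_def[of N])
    finally have 1: "(Q **\<^sub>\<infinity> N) i j = (\<Sum>k. N i k * N k j) + (\<Sum>k. N i k * (Q **\<^sub>\<infinity> N) k j)" .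
    have "(N **\<^sub>\<infinity> Q) i j = (\<Sum>k. N i k * Q k j)" by (simp add: imat_mult_def)
    also have "\<dots> = (\<Sum>k. N i k * N k j + N i k * (N **\<^sub>\<infinity> Q) k j)"
      by (simp only: Q_right[of _ j] distrib_left)
    also have "\<dots> = (\<Sum>k. N i k * N k j) + (\<Sum>k. N i k * (N **\<^sub>\<infinity> Q) k j)"
      using dvd_N' by (intro fps_suminf_add) auto
    finally have "Z i j = (\<Sum>k. N i k * (Q **\<^sub>\<infinity> N) k j) - (\<Sum>k. N i k * (N **\<^sub>\<infinity> Q) k j)"
      using 1 by (simp add: Z_def)
    also have "\<dots> = (\<Sum>k. N i k * (Q **\<^sub>\<infinity> N) k j - N i k * (N **\<^sub>\<infinity> Q) k j)"
      using dvd_N' by (intro fps_suminf_diff[symmetric]) auto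
    finally show ?thesis by (simp add: Z_def imat_mult_def[of N Z] right_diff_distrib)
  qed
  then have "Z i j = 0" by (rule fixpoint_eq_0)
  then show ?thesis by (simp add: Z_def)
qed

definition B :: "nat \<Rightarrow> nat \<Rightarrow> real fps" where
  "B i j = imat_one i j + Q i j"

lemma sums_one_minus_N_mult:
  "(\<lambda>k. imat_minus imat_one N i k * M k j) sums (M i j - (N **\<^sub>\<infinity> M) i j)"
proof -
  have "(\<lambda>k. (if i = k then 1 else 0) * M k j - N i k * M k j) sums (M i j - (N **\<^sub>\<infinity> M) i j)"
    unfolding imat_mult_def
    using dvd_N' by (intro fps_sums_diff sums_delta_left fps_sums_suminf) auto
  then show ?thesis by (simp add: imat_minus_def imat_one_def left_diff_distrib)
qed

lemma sums_mult_one_minus_N: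
  "(\<lambda>k. M i k * imat_minus imat_one N k j) sums (M i j - (M **\<^sub>\<infinity> N) i j)"
proof -
  have "(\<lambda>k. M i k * (if k = j then 1 else 0) - M i k * N k j) sums (M i j - (M **\<^sub>\<infinity> N) i j)"
    unfolding imat_mult_def
    using dvd_N' by (intro fps_sums_diff sums_delta_right fps_sums_suminf) auto
  then show ?thesis by (simp add: imat_minus_def imat_one_def right_diff_distrib)
qed

lemma sums_mult_B:
  assumes "\<And>k. fps_X ^ k dvd v i k"
  shows "(\<lambda>k. v i k * B k j) sums (v i j + (v **\<^sub>\<infinity> Q) i j)"
proof -
  have "(\<lambda>k. v i k * (if k = j then 1 else 0) + v i k * Q k j) sums (v i j + (v **\<^sub>\<infinity> Q) i j)"
    unfolding imat_mult_def
    using dvd_Q by (intro fps_sums_add sums_delta_right fps_sums_suminf) auto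
  then show ?thesis by (simp add: B_def imat_one_def distrib_left)
qed

lemma N_mult_B: "(N **\<^sub>\<infinity> B) i j = Q i j"
  using sums_unique[OF sums_mult_B[of N i j]] dvd_N' Q_right[of i j] by (simp add: imat_mult_def)

lemma B_mult_N: "(B **\<^sub>\<infinity> N) i j = Q i j"
proof -
  have "(\<lambda>k. (if i = k then 1 else 0) * N k j + Q i k * N k j) sums (N i j + (Q **\<^sub>\<infinity> N) i j)"
    unfolding imat_mult_def
    using dvd_N' by (intro fps_sums_add sums_delta_left fps_sums_suminf) auto
  then have "(\<lambda>k. B i k * N k j) sums (N i j + (Q **\<^sub>\<infinity> N) i j)"
    by (simp add: B_def imat_one_def distrib_right)
  from sums_unique[OF this] show ?thesis by (simp add: imat_mult_def[of B] Q_commute Q_right)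
qed

lemma inverts_B: "imat_inverts (imat_minus imat_one N) B"
proof -
  have 1: "(\<lambda>k. imat_minus imat_one N i k * B k j) sums imat_one i j" for i j
    using sums_one_minus_N_mult[of i B j] by (simp add: N_mult_B B_def)
  have 2: "(\<lambda>k. B i k * imat_minus imat_one N k j) sums imat_one i j" for i j
    using sums_mult_one_minus_N[of B i j] by (simp add: B_mult_N B_def)
  show ?thesis
    unfolding imat_inverts_def imat_mult_defined_def imat_mult_def
    by (simp add: fun_eq_iff sums_summable[OF 1] sums_summable[OF 2]
        sums_unique[OF 1, symmetric] sums_unique[OF 2, symmetric])
qed

text \<open>A right inverse M satisfies M = I + NM, so two of them differ by a fixed point. The
  competitor \<open>B'\<close> is arbitrary, without any decay of its entries.\<close>

lemma inverts_unique:
  assumes "imat_inverts (imat_minus imat_one N) B'"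
  shows "B' = B"
proof -
  have fix_eq: "M i j = imat_one i j + (N **\<^sub>\<infinity> M) i j"
    if "imat_inverts (imat_minus imat_one N) M" for M i j
  proof -
    have "(imat_minus imat_one N **\<^sub>\<infinity> M) i j = imat_one i j"
      using that by (simp add: imat_inverts_def)
    then show ?thesis
      using sums_unique[OF sums_one_minus_N_mult[of i M j]] by (simp add: imat_mult_def algebra_simps)
  qed
  define Z where "Z i j = B' i j - B i j" for i j
  have "Z i j = (N **\<^sub>\<infinity> Z) i j" for i j
  proof -
    have "Z i j = (N **\<^sub>\<infinity> B') i j - (N **\<^sub>\<infinity> B) i j"
      unfolding Z_def using fix_eq[OF assms, of i j] fix_eq[OF inverts_B, of i j] by simp
    also have "\<dots> = (\<Sum>k. N i k * B' k j - N i k * B k j)"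
      unfolding imat_mult_def using dvd_N' by (intro fps_suminf_diff[symmetric]) auto
    finally show ?thesis by (simp add: Z_def imat_mult_def[of N Z] right_diff_distrib)
  qed
  then have "Z i j = 0" for i j by (rule fixpoint_eq_0)
  then show ?thesis by (simp add: Z_def fun_eq_iff)
qed

lemma imat_inv_eq: "imat_inv (imat_minus imat_one N) = B"
  unfolding imat_inv_def using inverts_B inverts_unique by (rule the_equality)

text \<open>With v = y - yN one gets vQ = yQ - (yN)Q = y(Q - NQ) = yN, hence v(I + Q) = y. The decay
  of \<open>y\<close> and \<open>Q\<close> licenses the associativity used here.\<close>

lemma row_solution:
  assumes y: "\<And>k. fps_X ^ k dvd y i k" and v: "\<And>j. v i j = y i j - (y **\<^sub>\<infinity> N) i j"
  shows "(\<lambda>k. v i k * B k j) sums y i j"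
proof -
  have dv: "fps_X ^ k dvd v i k" for k
    unfolding v imat_mult_def using y dvd_N' by (intro dvd_diff fps_dvd_suminf) auto
  have "(v **\<^sub>\<infinity> Q) i j = (\<Sum>k. y i k * Q k j - (y **\<^sub>\<infinity> N) i k * Q k j)"
    by (simp add: imat_mult_def[of v] v left_diff_distrib)
  also have "\<dots> = (y **\<^sub>\<infinity> Q) i j - (y **\<^sub>\<infinity> N **\<^sub>\<infinity> Q) i j"
    unfolding imat_mult_def[of _ Q] using dvd_Q by (intro fps_suminf_diff) auto
  also have "(y **\<^sub>\<infinity> N **\<^sub>\<infinity> Q) i j = (y **\<^sub>\<infinity> (N **\<^sub>\<infinity> Q)) i j"
    using y dvd_Q by (rule imat_mult_assoc)
  also have "(y **\<^sub>\<infinity> Q) i j - (y **\<^sub>\<infinity> (N **\<^sub>\<infinity> Q)) i j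
      = (\<Sum>k. y i k * Q k j - y i k * (N **\<^sub>\<infinity> Q) k j)"
    unfolding imat_mult_def[of y] using y by (intro fps_suminf_diff[symmetric]) auto
  also have "\<dots> = (y **\<^sub>\<infinity> N) i j"
    by (simp add: imat_mult_def[of y] Q_right[of _ j] flip: right_diff_distrib)
  finally have "v i j + (v **\<^sub>\<infinity> Q) i j = y i j" using v by simp
  then show ?thesis using sums_mult_B[of v i j, OF dv] by simp
qed

end

section \<open>Generating functions\<close>

text \<open>The binomial coefficient chooses the labels of the top rank, which
  \<open>layer_count\<close> takes as fixed.\<close>

definition layer_egf :: "nat set \<Rightarrow> nat \<Rightarrow> nat \<Rightarrow> real fps" where
  "layer_egf S k t = Abs_fps (\<lambda>n. real ((n choose t) * layer_count S k n t) / fact n)"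

lemma layer_egf_eq_0: "t \<notin> S \<Longrightarrow> layer_egf S k t = 0" "layer_egf S k 0 = 0"
  by (simp_all add: layer_egf_def layer_count_eq_0 fps_eq_iff)

text \<open>The two bounds let sums over heights and over top rank sizes converge; the shift to
  \<open>Suc t\<close> matches matrix indices starting at 0.\<close>

lemma dvd_layer_egf: "fps_X ^ k dvd layer_egf S k t" "fps_X ^ t dvd layer_egf S k (Suc t)"
  by (auto simp: fps_X_power_dvd_iff layer_egf_def layer_count_height)

lemma layer_egf_0:
  "layer_egf S 0 t = (if 0 < t \<and> t \<in> S then fps_const (1 / fact t) * fps_X ^ t else 0)"
  by (auto simp: fps_eq_iff layer_egf_def fps_X_power_iff)

text \<open>Truncating the shifted series at \<open>n\<close> includes one term too many,
  \<open>f (Suc n)\<close>; the last assumption disposes of it.\<close>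

lemma suminf_Suc_index_nth:
  fixes f :: "nat \<Rightarrow> real fps"
  assumes "f 0 = 0" "\<And>i. fps_X ^ i dvd f (Suc i)" "f (Suc n) $ n = 0"
  shows "(\<Sum>i. f (Suc i)) $ n = (\<Sum>t\<le>n. f t $ n)"
proof -
  have "(\<Sum>i. f (Suc i)) $ n = (\<Sum>i\<le>n. f (Suc i) $ n)"
    using assms by (intro fps_suminf_nth) auto
  also have "\<dots> = (\<Sum>t\<le>Suc n. f t $ n)" using assms(1) by (subst sum.atMost_Suc_shift) simp
  finally show ?thesis using assms(3) by simp
qed

text \<open>Since (n choose t)/n! = 1/(t! (n - t)!), the recursion for the counts becomes a product:
  x^t/t! for the new rank times the series of the \<open>m = n - t\<close> points below it.\<close>

lemma layer_egf_Suc: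
  "layer_egf S (Suc k) t = (if 0 < t \<and> t \<in> S then fps_const (1 / fact t) * fps_X ^ t *
     (\<Sum>i. layer_egf S k (Suc i) * of_nat (psi_s (Suc i) t)) else 0)"
proof (cases "0 < t \<and> t \<in> S")
  case False
  then show ?thesis by (auto simp: layer_egf_eq_0)
next
  case True
  have "layer_egf S (Suc k) t $ n = (fps_const (1 / fact t) * fps_X ^ t *
     (\<Sum>i. layer_egf S k (Suc i) * of_nat (psi_s (Suc i) t))) $ n" for n
  proof (cases "t \<le> n")
    case False
    then show ?thesis by (simp add: layer_egf_def mult.assoc fps_X_power_mult_nth)
  next
    case le: True
    define m where "m = n - t"
    have "(\<Sum>i. layer_egf S k (Suc i) * of_nat (psi_s (Suc i) t)) $ m
      = (\<Sum>s\<le>m. (layer_egf S k s * of_nat (psi_s s t)) $ m)"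
    proof (rule suminf_Suc_index_nth)
      show "fps_X ^ i dvd layer_egf S k (Suc i) * of_nat (psi_s (Suc i) t)" for i
        using dvd_layer_egf(2) by (rule dvd_mult2)
    qed (simp add: layer_egf_eq_0, simp add: layer_egf_def fps_of_nat[symmetric])
    also have "\<dots> = (\<Sum>s\<le>m. real ((m choose s) * (layer_count S k m s * psi_s s t))) / fact m"
      by (simp add: layer_egf_def fps_of_nat[symmetric] sum_divide_distrib mult.assoc)
    finally have "(fps_const (1 / fact t) * fps_X ^ t *
        (\<Sum>i. layer_egf S k (Suc i) * of_nat (psi_s (Suc i) t))) $ n
      = (\<Sum>s\<le>m. real ((m choose s) * (layer_count S k m s * psi_s s t))) / (fact t * fact m)"
      using le by (simp add: mult.assoc fps_X_power_mult_nth m_def)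
    moreover have "real (n choose t) / fact n = 1 / (fact t * fact m)"
      using le by (simp add: binomial_fact m_def field_simps)
    then have "layer_egf S (Suc k) t $ n =
        (\<Sum>s\<le>m. real ((m choose s) * (layer_count S k m s * psi_s s t))) / (fact t * fact m)"
      using True le by (simp add: layer_egf_def m_def field_simps)
    ultimately show ?thesis by simp
  qed
  then show ?thesis using True by (simp add: fps_eq_iff)
qed

definition total_egf :: "nat set \<Rightarrow> nat \<Rightarrow> real fps" where
  "total_egf S t = (\<Sum>k. layer_egf S k t)"

lemma dvd_total_egf: "fps_X ^ t dvd total_egf S (Suc t)"
  unfolding total_egf_def using dvd_layer_egf by (intro fps_dvd_suminf)

lemma total_egf_eq_0: "t \<notin> S \<Longrightarrow> total_egf S t = 0"
  by (simp add: total_egf_def layer_egf_eq_0)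

text \<open>Posets with a single rank give the summand 1; for the others the sums over heights and
  over the size of the rank below the top are exchanged.\<close>

lemma total_egf_rec:
  assumes "0 < t" "t \<in> S"
  shows "total_egf S t = fps_const (1 / fact t) * fps_X ^ t *
     (1 + (\<Sum>i. total_egf S (Suc i) * of_nat (psi_s (Suc i) t)))"
proof -
  let ?c = "fps_const (1 / fact t) * fps_X ^ t :: real fps"
  let ?g = "\<lambda>k i. layer_egf S k (Suc i) * of_nat (psi_s (Suc i) t)"
  have d: "fps_X ^ k dvd ?g k i" "fps_X ^ i dvd ?g k i" for k i
    using dvd_layer_egf by (auto intro: dvd_mult2)
  have "total_egf S t = layer_egf S 0 t + (\<Sum>k. layer_egf S (Suc k) t)"
    unfolding total_egf_def using dvd_layer_egf by (intro fps_suminf_split_head)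
  also have "\<dots> = ?c + (\<Sum>k. ?c * (\<Sum>i. ?g k i))"
    using assms by (simp add: layer_egf_0 layer_egf_Suc)
  also have "(\<Sum>k. ?c * (\<Sum>i. ?g k i)) = ?c * (\<Sum>k. \<Sum>i. ?g k i)"
    using d by (intro fps_suminf_mult_left fps_dvd_suminf)
  also have "(\<Sum>k. \<Sum>i. ?g k i) = (\<Sum>i. \<Sum>k. ?g k i)"
    using d by (rule fps_suminf_swap)
  also have "\<dots> = (\<Sum>i. total_egf S (Suc i) * of_nat (psi_s (Suc i) t))"
    unfolding total_egf_def using dvd_layer_egf by (subst fps_suminf_mult_right) auto
  finally show ?thesis by (simp add: distrib_left)
qed

lemma egf_num_graded_rk:
  assumes "1 \<le> k"
  shows "egf (\<lambda>n. num_graded_rk n r k) = (\<Sum>i. layer_egf {..r} (k - 1) (Suc i))"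
proof (rule fps_ext)
  fix n
  have "(\<Sum>i. layer_egf {..r} (k - 1) (Suc i)) $ n = (\<Sum>t\<le>n. layer_egf {..r} (k - 1) t $ n)"
    by (rule suminf_Suc_index_nth) (auto simp: layer_egf_eq_0 dvd_layer_egf, simp add: layer_egf_def)
  then show "egf (\<lambda>n. num_graded_rk n r k) $ n = (\<Sum>i. layer_egf {..r} (k - 1) (Suc i)) $ n"
    using assms by (simp add: egf_def num_graded_rk_eq layer_egf_def sum_divide_distrib)
qed

lemma suminf_total_egf_nth:
  "(\<Sum>i. total_egf S (Suc i)) $ n =
    real (\<Sum>k<n. \<Sum>t\<le>n. (n choose t) * layer_count S k n t) / fact n"
proof -
  have total: "total_egf S t $ n = (\<Sum>k<n. layer_egf S k t $ n)" for t
  proof -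
    have "total_egf S t $ n = (\<Sum>k\<le>n. layer_egf S k t $ n)"
      unfolding total_egf_def using dvd_layer_egf by (intro fps_suminf_nth) auto
    also have "\<dots> = (\<Sum>k<n. layer_egf S k t $ n)"
      by (simp add: lessThan_Suc_atMost[symmetric] layer_egf_def layer_count_height)
    finally show ?thesis .
  qed
  have "(\<Sum>i. total_egf S (Suc i)) $ n = (\<Sum>t\<le>n. total_egf S t $ n)"
  proof (rule suminf_Suc_index_nth)
    show "total_egf S (Suc n) $ n = 0" unfolding total by (simp add: layer_egf_def binomial_eq_0)
  qed (simp_all add: total_egf_def[of _ 0] layer_egf_eq_0 dvd_total_egf)
  also have "\<dots> = (\<Sum>k<n. \<Sum>t\<le>n. layer_egf S k t $ n)" unfolding total by (rule sum.swap)
  finally show ?thesis by (simp add: layer_egf_def sum_divide_distrib)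
qed

lemma egf_num_graded_r: "egf (\<lambda>n. num_graded_r n r) = (\<Sum>i. total_egf {..r} (Suc i))"
  by (rule fps_ext) (simp only: suminf_total_egf_nth num_graded_r_eq egf_def Abs_fps_inverse fps_nth_Abs_fps)

lemma egf_num_graded: "egf num_graded = (\<Sum>i. total_egf UNIV (Suc i))"
  by (rule fps_ext) (simp only: suminf_total_egf_nth num_graded_eq egf_def fps_nth_Abs_fps)

section \<open>Passing from x to its square root\<close>

definition DAD_inf :: "nat \<Rightarrow> nat \<Rightarrow> real fps" where
  "DAD_inf i j = sqrt_entry (Suc i) * of_nat (psi_s (Suc i) (Suc j)) * sqrt_entry (Suc j)"

lemma compose_const_X_power_mult:
  "(fps_const (1 / fact t) * fps_X ^ t * F) oo sqrt_x ^ 2 = sqrt_entry t * (sqrt_entry t * (F oo sqrt_x ^ 2))"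
proof -
  have "(fps_const (1 / fact t) * fps_X ^ t * F) oo sqrt_x ^ 2
      = fps_const (1 / fact t) * (sqrt_x ^ 2) ^ t * (F oo sqrt_x ^ 2)"
    by (simp add: fps_compose_mult_distrib fps_compose_power fps_X_power_compose)
  also have "fps_const (1 / fact t) * (sqrt_x ^ 2) ^ t = sqrt_entry t * sqrt_entry t"
    by (simp only: sqrt_entry_square[symmetric] power2_eq_square[of "sqrt_entry t"])
  finally show ?thesis by (simp only: mult.assoc)
qed

lemma compose_suminf_psi:
  assumes "\<And>i. fps_X ^ i dvd f i"
  shows "(\<Sum>i. f i * of_nat (psi_s (Suc i) t)) oo sqrt_x ^ 2 =
    (\<Sum>i. (f i oo sqrt_x ^ 2) * of_nat (psi_s (Suc i) t))"
  using assms
  by (subst fps_suminf_compose) (auto simp: fps_compose_mult_distrib fps_of_nat[symmetric])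

lemma layer_egf_compose:
  "layer_egf S 0 (Suc j) oo sqrt_x ^ 2 = (if Suc j \<in> S then sqrt_entry (Suc j) * sqrt_entry (Suc j) else 0)"
  "layer_egf S (Suc k) (Suc j) oo sqrt_x ^ 2 = (if Suc j \<in> S then sqrt_entry (Suc j) * (sqrt_entry (Suc j) *
     (\<Sum>i. (layer_egf S k (Suc i) oo sqrt_x ^ 2) * of_nat (psi_s (Suc i) (Suc j)))) else 0)"
proof -
  show "layer_egf S 0 (Suc j) oo sqrt_x ^ 2 = (if Suc j \<in> S then sqrt_entry (Suc j) * sqrt_entry (Suc j) else 0)"
    using compose_const_X_power_mult[of "Suc j" 1] by (simp add: layer_egf_0)
  show "layer_egf S (Suc k) (Suc j) oo sqrt_x ^ 2 = (if Suc j \<in> S then sqrt_entry (Suc j) * (sqrt_entry (Suc j) *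
     (\<Sum>i. (layer_egf S k (Suc i) oo sqrt_x ^ 2) * of_nat (psi_s (Suc i) (Suc j)))) else 0)"
    using dvd_layer_egf
    by (simp add: layer_egf_Suc compose_const_X_power_mult compose_suminf_psi del: fact_Suc power_Suc)
qed

text \<open>The row vector \<open>y\<close> of the overview: \<open>total_egf\<close> in the
  variable \<open>sqrt_x\<close> with one factor \<open>sqrt_entry (Suc j)\<close> removed. Writing
  out the recursion avoids a division and gives a value even where
  \<open>Suc j \<notin> S\<close>.\<close>

definition total_row :: "nat set \<Rightarrow> nat \<Rightarrow> real fps" where
  "total_row S j = sqrt_entry (Suc j) * (1 + (\<Sum>i. (total_egf S (Suc i) oo sqrt_x ^ 2) * of_nat (psi_s (Suc i) (Suc j))))"

lemma total_egf_compose: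
  "total_egf S (Suc j) oo sqrt_x ^ 2 = (if Suc j \<in> S then sqrt_entry (Suc j) * total_row S j else 0)"
  using dvd_total_egf
  by (simp add: total_egf_eq_0 total_egf_rec compose_const_X_power_mult compose_suminf_psi total_row_def
      fps_compose_add_distrib del: fact_Suc power_Suc)

lemma dvd_compose_total_egf: "fps_X ^ i dvd total_egf S (Suc i) oo sqrt_x ^ 2"
  using fps_suminf_compose(2)[of "\<lambda>i. total_egf S (Suc i)"] dvd_total_egf by blast

text \<open>The root split off from \<open>total_egf\<close> becomes the left factor of
  \<open>DAD_inf\<close>. For \<open>UNIV\<close> this is the full infinite system, for
  \<open>{..r}\<close> the condition cuts it down to the r by r block.\<close>

lemma total_row_rec:
  "total_row S j = sqrt_entry (Suc j) + (\<Sum>i. if Suc i \<in> S then total_row S i * DAD_inf i j else 0)"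
proof -
  have "total_row S j = sqrt_entry (Suc j) +
      sqrt_entry (Suc j) * (\<Sum>i. (total_egf S (Suc i) oo sqrt_x ^ 2) * of_nat (psi_s (Suc i) (Suc j)))"
    by (simp add: total_row_def distrib_left)
  also have "sqrt_entry (Suc j) * (\<Sum>i. (total_egf S (Suc i) oo sqrt_x ^ 2) * of_nat (psi_s (Suc i) (Suc j)))
      = (\<Sum>i. sqrt_entry (Suc j) * ((total_egf S (Suc i) oo sqrt_x ^ 2) * of_nat (psi_s (Suc i) (Suc j))))"
    using dvd_compose_total_egf by (intro fps_suminf_mult_left[symmetric] dvd_mult2)
  also have "\<dots> = (\<Sum>i. if Suc i \<in> S then total_row S i * DAD_inf i j else 0)"
    by (rule arg_cong[of _ _ suminf]) (auto simp: total_egf_compose DAD_inf_def mult_ac fun_eq_iff)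
  finally show ?thesis .
qed

lemma dvd_sqrt_entry: "fps_X ^ i dvd sqrt_entry i"
  by (simp add: sqrt_entry_def)

lemma dvd_sqrt_entry': "fps_X ^ i dvd sqrt_entry (Suc i)"
  using dvd_sqrt_entry[of "Suc i"] by (auto dest: dvd_mult_right)

lemma dvd_total_row: "fps_X ^ i dvd total_row S i"
  unfolding total_row_def using dvd_sqrt_entry' by (rule dvd_mult2)

section \<open>The infinite matrix formula\<close>

interpretation DAD_inf: contraction DAD_inf
proof
  fix i j
  have "fps_X ^ (Suc i + Suc j) dvd sqrt_entry (Suc i) * sqrt_entry (Suc j)"
    unfolding power_add using dvd_sqrt_entry dvd_sqrt_entry by (rule mult_dvd_mono)
  moreover have "DAD_inf i j = sqrt_entry (Suc i) * sqrt_entry (Suc j) * of_nat (psi_s (Suc i) (Suc j))"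
    by (simp add: DAD_inf_def mult_ac)
  ultimately have "fps_X ^ (Suc i + Suc j) dvd DAD_inf i j" by (metis dvd_mult2)
  then show "fps_X ^ Suc (i + j) dvd DAD_inf i j"
    by (rule dvd_trans[rotated]) (rule le_imp_power_dvd, simp)
qed

text \<open>The entries of \<open>A_inf\<close> are constants without decay; the products exist
  because \<open>D_inf\<close> is diagonal and each sum has at most one nonzero term.\<close>

lemma imat_DAD:
  "imat_mult_defined D_inf A_inf" "imat_mult_defined (D_inf **\<^sub>\<infinity> A_inf) D_inf"
  "D_inf **\<^sub>\<infinity> A_inf **\<^sub>\<infinity> D_inf = DAD_inf"
proof -
  have D: "D_inf i k = sqrt_entry (Suc i) * (if i = k then 1 else 0)"
    "D_inf i k = (if i = k then 1 else 0) * sqrt_entry (Suc k)" for i k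
    by (simp_all add: D_inf_def V_inf_def)
  have 1: "(\<lambda>k. D_inf i k * A_inf k j) sums (sqrt_entry (Suc i) * A_inf i j)" for i j
    using sums_delta_left[of i "\<lambda>k. sqrt_entry (Suc k) * A_inf k j"] by (simp add: D(2) mult.assoc)
  then have DA: "D_inf **\<^sub>\<infinity> A_inf = (\<lambda>i j. sqrt_entry (Suc i) * A_inf i j)"
    unfolding imat_mult_def using sums_unique by (metis (no_types, lifting))
  have 2: "(\<lambda>k. (D_inf **\<^sub>\<infinity> A_inf) i k * D_inf k j) sums DAD_inf i j" for i j
    unfolding DA
    using sums_delta_right[of "\<lambda>k. sqrt_entry (Suc i) * A_inf i k * sqrt_entry (Suc k)" j]
    by (simp add: D(1) mult.assoc DAD_inf_def A_inf_def)
  show "imat_mult_defined D_inf A_inf" "imat_mult_defined (D_inf **\<^sub>\<infinity> A_inf) D_inf"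
    using sums_summable[OF 1] sums_summable[OF 2] by (simp_all add: imat_mult_defined_def)
  show "D_inf **\<^sub>\<infinity> A_inf **\<^sub>\<infinity> D_inf = DAD_inf"
    by (intro ext) (simp add: imat_mult_def[of "D_inf **\<^sub>\<infinity> A_inf"] sums_unique[OF 2, symmetric])
qed

lemma infinite_case:
  defines "VT \<equiv> imat_transpose V_inf"
  shows "imat_mult_defined VT DAD_inf.B" "imat_mult_defined (VT **\<^sub>\<infinity> DAD_inf.B) V_inf"
    "egf num_graded oo sqrt_x ^ 2 = (VT **\<^sub>\<infinity> DAD_inf.B **\<^sub>\<infinity> V_inf) () ()"
proof -
  have "VT u j = total_row UNIV j - ((\<lambda>_. total_row UNIV) **\<^sub>\<infinity> DAD_inf) u j" for u j
    using total_row_rec[of UNIV j] by (simp add: VT_def imat_transpose_def V_inf_def imat_mult_def)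
  then have 1: "(\<lambda>k. VT u k * DAD_inf.B k j) sums total_row UNIV j" for u j
    using DAD_inf.row_solution[of "\<lambda>_. total_row UNIV" u VT] dvd_total_row by simp
  then show "imat_mult_defined VT DAD_inf.B"
    using sums_summable by (auto simp: imat_mult_defined_def)
  have VB: "VT **\<^sub>\<infinity> DAD_inf.B = (\<lambda>_. total_row UNIV)"
    by (intro ext) (simp add: imat_mult_def sums_unique[OF 1, symmetric])
  show "imat_mult_defined (VT **\<^sub>\<infinity> DAD_inf.B) V_inf"
    unfolding VB imat_mult_defined_def by (intro allI fps_summable dvd_mult2 dvd_total_row)
  have "egf num_graded oo sqrt_x ^ 2 = (\<Sum>i. total_egf UNIV (Suc i) oo sqrt_x ^ 2)"
    unfolding egf_num_graded using dvd_total_egf by (rule fps_suminf_compose)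
  also have "\<dots> = (\<Sum>i. total_row UNIV i * sqrt_entry (Suc i))"
    by (simp add: total_egf_compose mult.commute)
  also have "\<dots> = (VT **\<^sub>\<infinity> DAD_inf.B **\<^sub>\<infinity> V_inf) () ()"
    unfolding VB by (simp add: imat_mult_def V_inf_def)
  finally show "egf num_graded oo sqrt_x ^ 2 = (VT **\<^sub>\<infinity> DAD_inf.B **\<^sub>\<infinity> V_inf) () ()" .
qed

section \<open>The finite matrix formulas\<close>

lemma DAD_mat: "D_mat r * A_mat r * D_mat r = mat r r (\<lambda>(i, j). DAD_inf i j)"
proof -
  have "D_mat r * A_mat r = mat r r (\<lambda>(i, j). sqrt_entry (Suc i) * of_nat (psi_s (Suc i) (Suc j)))"
    by (intro eq_matI)
      (auto simp: D_mat_def A_mat_def V_mat_def scalar_prod_def if_distrib[of "\<lambda>x. x * _"] sum.delta cong: if_cong)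
  then show ?thesis
    by (intro eq_matI)
      (auto simp: D_mat_def V_mat_def scalar_prod_def DAD_inf_def if_distrib sum.delta' cong: if_cong)
qed

lemma mat_inv_eqI:
  fixes M :: "'a :: comm_ring_1 mat"
  assumes M: "M \<in> carrier_mat n n" and B: "B \<in> carrier_mat n n" and MB: "M * B = 1\<^sub>m n" and BM: "B * M = 1\<^sub>m n"
  shows "invertible_mat M" "mat_inv M = B"
proof -
  have inv: "inverts_mat M B \<and> inverts_mat B M"
    using assms by (simp add: inverts_mat_def)
  then show "invertible_mat M" using M by (auto simp: invertible_mat_def)
  show "mat_inv M = B"
    unfolding mat_inv_def
  proof (rule the_equality)
    fix C assume C: "inverts_mat M C \<and> inverts_mat C M"
    then have eq: "M * C = 1\<^sub>m n" "C * M = 1\<^sub>m (dim_row C)" using M by (auto simp: inverts_mat_def)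
    \<comment> \<open>\<open>inverts_mat\<close> leaves the shape of \<open>C\<close> open;
      comparing column counts in both equations determines it.\<close>
    have "dim_col C = n" using arg_cong[OF eq(1), of dim_col] by simp
    moreover have "dim_row C = n" using arg_cong[OF eq(2), of dim_col] M by simp
    ultimately have Cc: "C \<in> carrier_mat n n" by auto
    have "C = (B * M) * C" using BM Cc by simp
    also have "\<dots> = B * (M * C)" using B M Cc by (rule assoc_mult_mat)
    finally show "C = B" using eq(1) B by simp
  qed (rule inv)
qed

text \<open>Modulo \<open>sqrt_x\<close> the matrix is the identity, so its determinant has constant
  term 1 and is a unit among power series; the adjugate then gives the inverse.\<close>

lemma one_minus_DAD_inverse:
  defines "M r \<equiv> 1\<^sub>m r - mat r r (\<lambda>(i, j). DAD_inf i j)"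
  obtains B where "B \<in> carrier_mat r r" "M r * B = 1\<^sub>m r" "B * M r = 1\<^sub>m r"
proof -
  interpret nth0: comm_ring_hom "\<lambda>F :: real fps. F $ 0"
    by unfold_locales (simp_all add: fps_mult_nth)
  have M: "M r \<in> carrier_mat r r" by (simp add: M_def minus_carrier_mat)
  have "DAD_inf i j $ 0 = 0" for i j
    using DAD_inf.dvd_N'(3)[of i j] fps_X_power_dvd_iff[of 1 "DAD_inf i j"] by simp
  then have "map_mat (\<lambda>F. F $ 0) (M r) = 1\<^sub>m r"
    by (intro eq_matI) (auto simp: M_def)
  then have "det (M r) $ 0 = 1" using nth0.hom_det[of "M r"] by simp
  then have "det (M r) dvd 1" by simp
  then obtain c where c: "1 = det (M r) * c" by (rule dvdE)
  note adj = adj_mat[OF M]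
  show thesis
  proof (rule that)
    show "c \<cdot>\<^sub>m adj_mat (M r) \<in> carrier_mat r r" using adj by simp
    have 1: "c \<cdot>\<^sub>m (det (M r) \<cdot>\<^sub>m 1\<^sub>m r) = 1\<^sub>m r" using c by (auto simp: mult.commute)
    show "M r * (c \<cdot>\<^sub>m adj_mat (M r)) = 1\<^sub>m r" using mult_smult_distrib[OF M adj(1)] adj 1 by simp
    show "(c \<cdot>\<^sub>m adj_mat (M r)) * M r = 1\<^sub>m r" using mult_smult_assoc_mat[OF adj(1) M] adj 1 by simp
  qed
qed

lemma row_mult_mat_entry:
  assumes "U \<in> carrier_mat 1 r" "M \<in> carrier_mat r c" "j < c"
  shows "(U * M) $$ (0, j) = (\<Sum>i<r. U $$ (0, i) * M $$ (i, j))"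
  using assms by (auto simp: scalar_prod_def lessThan_atLeast0)

lemma suminf_eq_sum_lessThan:
  assumes "\<And>i. r \<le> i \<Longrightarrow> f i = 0"
  shows "(\<Sum>i. f i :: real fps) = (\<Sum>i<r. f i)"
  using assms by (intro suminf_finite) auto

lemma finite_case_total:
  defines "M r \<equiv> 1\<^sub>m r - D_mat r * A_mat r * D_mat r"
  shows "invertible_mat (M r)"
    "egf (\<lambda>n. num_graded_r n r) oo sqrt_x ^ 2 = (transpose_mat (V_mat r) * mat_inv (M r) * V_mat r) $$ (0, 0)"
proof -
  let ?N = "mat r r (\<lambda>(i, j). DAD_inf i j)"
  have M: "M r = 1\<^sub>m r - ?N" by (simp add: M_def DAD_mat)
  obtain B where B: "B \<in> carrier_mat r r" "M r * B = 1\<^sub>m r" "B * M r = 1\<^sub>m r"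
    unfolding M by (rule one_minus_DAD_inverse)
  have Mc: "M r \<in> carrier_mat r r" by (simp add: M minus_carrier_mat)
  show "invertible_mat (M r)" by (rule mat_inv_eqI(1)[OF Mc B])
  have inv: "mat_inv (M r) = B" by (rule mat_inv_eqI(2)[OF Mc B])
  \<comment> \<open>The candidate for the transposed vector times the inverse. It suffices to check
    the product of \<open>y\<close> with \<open>M r\<close>, which is \<open>total_row_rec\<close>
    cut off at \<open>r\<close>.\<close>
  define y where "y = mat 1 r (\<lambda>(_, j). total_row {..r} j)"
  have yc: "y \<in> carrier_mat 1 r" by (simp add: y_def)
  have "y * M r = transpose_mat (V_mat r)"
  proof (rule eq_matI)
    fix u j assume "u < dim_row (transpose_mat (V_mat r))" "j < dim_col (transpose_mat (V_mat r))"
    then have u: "u = 0" and j: "j < r" by (auto simp: V_mat_def)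
    have "(\<Sum>i. if Suc i \<in> {..r} then total_row {..r} i * DAD_inf i j else 0)
        = (\<Sum>i<r. if Suc i \<in> {..r} then total_row {..r} i * DAD_inf i j else 0)"
      by (rule suminf_eq_sum_lessThan) simp
    also have "\<dots> = (\<Sum>i<r. total_row {..r} i * DAD_inf i j)" by (intro sum.cong) auto
    finally have "total_row {..r} j - (\<Sum>i<r. total_row {..r} i * DAD_inf i j) = sqrt_entry (Suc j)"
      using total_row_rec[of "{..r}" j] by simp
    moreover have "(y * M r) $$ (u, j) = (\<Sum>i<r. total_row {..r} i * ((if i = j then 1 else 0) - DAD_inf i j))"
      using u j by (simp add: y_def M scalar_prod_def lessThan_atLeast0)
    moreover have "\<dots> = total_row {..r} j - (\<Sum>i<r. total_row {..r} i * DAD_inf i j)"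
      using j by (simp add: right_diff_distrib sum_subtractf if_distrib[of "times _"] cong: if_cong)
    ultimately show "(y * M r) $$ (u, j) = transpose_mat (V_mat r) $$ (u, j)"
      using u j by (simp add: V_mat_def)
  qed (simp_all add: y_def M V_mat_def)
  then have "transpose_mat (V_mat r) * B = y * (M r * B)"
    using assoc_mult_mat[OF yc Mc B(1)] by simp
  then have y: "transpose_mat (V_mat r) * B = y" using B(2) yc by simp
  have "egf (\<lambda>n. num_graded_r n r) oo sqrt_x ^ 2 = (\<Sum>i. total_egf {..r} (Suc i) oo sqrt_x ^ 2)"
    unfolding egf_num_graded_r using dvd_total_egf by (rule fps_suminf_compose)
  also have "\<dots> = (\<Sum>i<r. total_egf {..r} (Suc i) oo sqrt_x ^ 2)"
    by (rule suminf_eq_sum_lessThan) (simp add: total_egf_compose)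
  also have "\<dots> = (\<Sum>i<r. total_row {..r} i * sqrt_entry (Suc i))"
    by (simp add: total_egf_compose mult.commute)
  also have "\<dots> = (y * V_mat r) $$ (0, 0)"
    by (simp add: y_def V_mat_def scalar_prod_def lessThan_atLeast0)
  finally show "egf (\<lambda>n. num_graded_r n r) oo sqrt_x ^ 2 =
      (transpose_mat (V_mat r) * mat_inv (M r) * V_mat r) $$ (0, 0)"
    by (simp add: inv y)
qed

text \<open>Entry \<open>j\<close> of the row after \<open>k\<close> multiplications is the series
  for \<open>k + 1\<close> ranks with \<open>j + 1\<close> elements on top, short of one root; the
  final factor \<open>V_mat r\<close> supplies it. A single rank takes no multiplication, hence the
  exponent \<open>k - 1\<close>.\<close>

lemma finite_case_height:
  assumes "1 \<le> k"
  shows "egf (\<lambda>n. num_graded_rk n r k) oo sqrt_x ^ 2 =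
    (transpose_mat (V_mat r) * (D_mat r * A_mat r * D_mat r) ^\<^sub>m (k - 1) * V_mat r) $$ (0, 0)"
proof -
  let ?N = "mat r r (\<lambda>(i, j). DAD_inf i j)"
  let ?u = "\<lambda>k. transpose_mat (V_mat r) * ?N ^\<^sub>m k"
  have V: "transpose_mat (V_mat r) \<in> carrier_mat 1 r" and N: "?N \<in> carrier_mat r r"
    by (simp_all add: V_mat_def)
  have Nk: "?N ^\<^sub>m k \<in> carrier_mat r r" for k using N by (rule pow_carrier_mat)
  have uc: "?u k \<in> carrier_mat 1 r" for k using V Nk by (rule mult_carrier_mat)
  have u: "layer_egf {..r} k (Suc j) oo sqrt_x ^ 2 = sqrt_entry (Suc j) * ?u k $$ (0, j)" if "j < r" for k j
    using that
  proof (induction k arbitrary: j)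
    case 0
    have "?u 0 = transpose_mat (V_mat r)" using V by simp
    then show ?case using 0 by (simp add: layer_egf_compose V_mat_def)
  next
    case (Suc k)
    have "?u (Suc k) = ?u k * ?N" using assoc_mult_mat[OF V Nk N] by simp
    then have "?u (Suc k) $$ (0, j) = (\<Sum>i<r. ?u k $$ (0, i) * DAD_inf i j)"
      using row_mult_mat_entry[OF uc N Suc.prems] Suc.prems by simp
    also have "\<dots> = (\<Sum>i<r. sqrt_entry (Suc j) *
        ((sqrt_entry (Suc i) * ?u k $$ (0, i)) * of_nat (psi_s (Suc i) (Suc j))))"
      by (simp add: DAD_inf_def mult_ac)
    also have "\<dots> = sqrt_entry (Suc j) *
        (\<Sum>i<r. (layer_egf {..r} k (Suc i) oo sqrt_x ^ 2) * of_nat (psi_s (Suc i) (Suc j)))"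
      unfolding sum_distrib_left by (intro sum.cong refl) (simp add: Suc.IH)
    also have "\<dots> = sqrt_entry (Suc j) *
        (\<Sum>i. (layer_egf {..r} k (Suc i) oo sqrt_x ^ 2) * of_nat (psi_s (Suc i) (Suc j)))"
      by (subst suminf_eq_sum_lessThan[of r]) (simp_all add: layer_egf_eq_0)
    finally show ?case using Suc.prems by (simp add: layer_egf_compose)
  qed
  have "egf (\<lambda>n. num_graded_rk n r k) oo sqrt_x ^ 2 = (\<Sum>i. layer_egf {..r} (k - 1) (Suc i) oo sqrt_x ^ 2)"
    unfolding egf_num_graded_rk[OF assms] using dvd_layer_egf(2) by (rule fps_suminf_compose)
  also have "\<dots> = (\<Sum>i<r. layer_egf {..r} (k - 1) (Suc i) oo sqrt_x ^ 2)"
    by (rule suminf_eq_sum_lessThan) (simp add: layer_egf_eq_0)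
  also have "\<dots> = (\<Sum>i<r. ?u (k - 1) $$ (0, i) * sqrt_entry (Suc i))"
    by (intro sum.cong refl) (simp add: u mult.commute)
  also have "\<dots> = (?u (k - 1) * V_mat r) $$ (0, 0)"
    using row_mult_mat_entry[OF uc, of "V_mat r" 1 0] by (simp add: V_mat_def)
  finally show ?thesis by (simp add: DAD_mat)
qed

theorem theorem3p1:
  shows
    "(\<forall>i j. int (psi_s i j) =
        (\<Sum>a = 0..i. \<Sum>b = 0..j.
           (-1) ^ ((i - a) + (j - b)) * int (i choose a) * int (j choose b) * 2 ^ (a * b)))
   \<and> (\<forall>r \<ge> 1.
        (\<forall>k \<ge> 1. egf (\<lambda>n. num_graded_rk n r k) oo sqrt_x ^ 2 =
           (transpose_mat (V_mat r) * (D_mat r * A_mat r * D_mat r) ^\<^sub>m (k - 1) * V_mat r) $$ (0, 0))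
      \<and> invertible_mat (1\<^sub>m r - D_mat r * A_mat r * D_mat r)
      \<and> egf (\<lambda>n. num_graded_r n r) oo sqrt_x ^ 2 =
          (transpose_mat (V_mat r) * mat_inv (1\<^sub>m r - D_mat r * A_mat r * D_mat r) * V_mat r) $$ (0, 0))
   \<and> (let DAD = D_inf **\<^sub>\<infinity> A_inf **\<^sub>\<infinity> D_inf;
          B = imat_inv (imat_minus imat_one DAD);
          VT = imat_transpose V_inf
      in imat_mult_defined D_inf A_inf \<and> imat_mult_defined (D_inf **\<^sub>\<infinity> A_inf) D_inf
       \<and> (\<exists>!B'. imat_inverts (imat_minus imat_one DAD) B')
       \<and> imat_mult_defined VT B \<and> imat_mult_defined (VT **\<^sub>\<infinity> B) V_inf
       \<and> egf num_graded oo sqrt_x ^ 2 = (VT **\<^sub>\<infinity> B **\<^sub>\<infinity> V_inf) () ())"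
proof -
  have "\<exists>!B'. imat_inverts (imat_minus imat_one DAD_inf) B'"
    using DAD_inf.inverts_B DAD_inf.inverts_unique by blast
  then show ?thesis
    unfolding Let_def imat_DAD(3) DAD_inf.imat_inv_eq
    by (intro conjI allI impI psi_s_altsum finite_case_height finite_case_total infinite_case imat_DAD)
qed

end
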